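(* Let $Q$ be a smooth $n$-dimensional manifold, let $h\in\mathbb{R}$ be a constant, and let $\varphi$ be a diffeomorphism of $T^*Q\times\mathbb{R}$ which advances the $t$-component by the constant time-step $h$, i.e. $t\circ\varphi = t+h$. Let $\psi$ be a smooth map from $T^*(Q\times\mathbb{R})$ to itself. Then the following are equivalent. (i) $(\psi,\varphi)$ is a canonical transformation. (ii) There exists a smooth function $W: T^*Q\times\mathbb{R}\to\mathbb{R}$ such that $$\varphi^*\tilde\omega_0 = \tilde\omega_0 - \mathrm{d}W\wedge \mathrm{d}t,$$ and $\psi = (\varphi\circ\mu,\; u + W\circ\mu)$, i.e. $\mu\circ\psi=\varphi\circ\mu$ and $u\circ\psi = u+W\circ\mu$.
   Context: Points of $T^*Q\times\mathbb{R}$ are written $(q,p,t)$ with $q\in Q$, $p\in T_q^*Q$, $t\in\mathbb{R}$. Points of the extended phase space $T^*(Q\times\mathbb{R})$ are written $(q,p,t,u)$, where $u\in\mathbb{R}$ is the fibre coordinate dual to $t$. The symbol $t$ denotes the time coordinate function on both spaces, and $u$ the corresponding coordinate function on $T^*(Q\times\mathbb{R})$. Let $\omega_0$ be the canonical symplectic form on $T^*Q$, in canonical coordinates $\omega_0=\mathrm{d}p_i\wedge \mathrm{d}q^i$ (summation over $i$). Let $\tau:T^*Q\times\mathbb{R}\to T^*Q$, $(q,p,t)\mapsto(q,p)$, and $\tilde\omega_0 := \tau^*\omega_0$. Let $\mu:T^*(Q\times\mathbb{R})\to T^*Q\times\mathbb{R}$, $(q,p,t,u)\mapsto(q,p,t)$.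 The symplectic form on the extended phase space is $\Omega_0 := \mu^*\tilde\omega_0 + \mathrm{d}u\wedge \mathrm{d}t$. A canonical transformation is a pair $(\psi,\varphi)$ of diffeomorphisms, $\psi$ of $T^*(Q\times\mathbb{R})$ and $\varphi$ of $T^*Q\times\mathbb{R}$, such that (1) $\mu\circ\psi=\varphi\circ\mu$ and (2) $\psi^*\Omega_0=\Omega_0$. *)

theory Defs
  imports "HOL-Analysis.Analysis" "HOL-Library.Function_Algebras"
begin

section \<open>Smooth maps between finite-dimensional inner product spaces\<close>

text \<open>
  The model spaces of manifolds. The class axiom is that of \<^class>\<open>euclidean_space\<close> without
  the requirement that the orthonormal basis be nonempty, so that dimension 0 is allowed. The
  dimension is \<^term>\<open>dim (UNIV :: 'a::real_vector set)\<close>.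
\<close>

class finite_dim_inner = real_inner +
  assumes finite_orthonormal_basis:
    "\<exists>B. finite B \<and> (\<forall>x\<in>B. \<forall>y\<in>B. inner x y = (if x = y then 1 else 0)) \<and>
         (\<forall>x. (\<forall>y\<in>B. inner x y = 0) \<longrightarrow> x = 0)"

instance euclidean_space \<subseteq> finite_dim_inner
proof
  show "\<exists>B :: 'a set. finite B \<and>
      (\<forall>x\<in>B. \<forall>y\<in>B. x \<bullet> y = (if x = y then 1 else 0)) \<and> (\<forall>x. (\<forall>y\<in>B. x \<bullet> y = 0) \<longrightarrow> x = 0)"
  proof (rule exI[where x = Basis], safe)
    show "finite (Basis :: 'a set)" by (rule finite_Basis)
  next
    fix x y :: 'a assume "x \<in> Basis" "y \<in> Basis"
    then show "x \<bullet> y = (if x = y then 1 else 0)" by (rule inner_Basis)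
  next
    fix x :: 'a assume "\<forall>y\<in>Basis. x \<bullet> y = 0"
    then show "x = 0" by (simp only: euclidean_all_zero_iff)
  qed
qed

instance prod :: (finite_dim_inner, finite_dim_inner) finite_dim_inner
proof
  obtain B :: "'a set" where "finite B \<and>
      (\<forall>x\<in>B. \<forall>y\<in>B. x \<bullet> y = (if x = y then 1 else 0)) \<and> (\<forall>x. (\<forall>y\<in>B. x \<bullet> y = 0) \<longrightarrow> x = 0)"
    using finite_orthonormal_basis ..
  then have B: "finite B" "\<forall>x\<in>B. \<forall>y\<in>B. x \<bullet> y = (if x = y then 1 else 0)"
      "\<forall>x. (\<forall>y\<in>B. x \<bullet> y = 0) \<longrightarrow> x = 0"
    by simp_all
  obtain C :: "'b set" where "finite C \<and>
      (\<forall>x\<in>C. \<forall>y\<in>C. x \<bullet> y = (if x = y then 1 else 0)) \<and> (\<forall>x. (\<forall>y\<in>C. x \<bullet> y = 0) \<longrightarrow> x = 0)"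
    using finite_orthonormal_basis ..
  then have C: "finite C" "\<forall>x\<in>C. \<forall>y\<in>C. x \<bullet> y = (if x = y then 1 else 0)"
      "\<forall>x. (\<forall>y\<in>C. x \<bullet> y = 0) \<longrightarrow> x = 0"
    by simp_all
  define D where "D = (\<lambda>b. (b, 0 :: 'b)) ` B \<union> (\<lambda>c. (0 :: 'a, c)) ` C"
  have nz: "0 \<notin> B" "0 \<notin> C"
    using B(2)[rule_format, of 0 0] C(2)[rule_format, of 0 0] by auto
  have "finite D" using B(1) C(1) by (simp add: D_def)
  moreover have "\<forall>x\<in>D. \<forall>y\<in>D. x \<bullet> y = (if x = y then 1 else 0)"
    unfolding D_def ball_Un ball_simps using B(2) C(2) nz by (auto simp: inner_prod_def)
  moreover have "x = 0" if "\<forall>y\<in>D. x \<bullet> y = 0" for x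
  proof -
    have "\<forall>b\<in>B. fst x \<bullet> b = 0" "\<forall>c\<in>C. snd x \<bullet> c = 0"
      using that by (simp_all add: D_def inner_prod_def ball_Un)
    then show ?thesis using B(3) C(3) by (simp add: prod_eq_iff)
  qed
  ultimately have "finite D \<and>
      (\<forall>x\<in>D. \<forall>y\<in>D. x \<bullet> y = (if x = y then 1 else 0)) \<and> (\<forall>x. (\<forall>y\<in>D. x \<bullet> y = 0) \<longrightarrow> x = 0)"
    by blast
  then show "\<exists>B :: ('a \<times> 'b) set. finite B \<and>
      (\<forall>x\<in>B. \<forall>y\<in>B. x \<bullet> y = (if x = y then 1 else 0)) \<and> (\<forall>x. (\<forall>y\<in>B. x \<bullet> y = 0) \<longrightarrow> x = 0)"
    by (rule exI[where x = D])
qed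

text \<open>
  These are only used on open sets of finite-dimensional spaces, where continuity of all
  directional derivatives is equivalent to continuity of the total derivative.
\<close>

primrec Ck_on :: "nat \<Rightarrow> 'a::real_normed_vector set \<Rightarrow> ('a \<Rightarrow> 'b::real_normed_vector) \<Rightarrow> bool" where
  "Ck_on 0 S f \<longleftrightarrow> continuous_on S f"
| "Ck_on (Suc k) S f \<longleftrightarrow>
     (\<forall>x\<in>S. f differentiable (at x)) \<and> (\<forall>v. Ck_on k S (\<lambda>x. frechet_derivative f (at x) v))"

definition smooth_on :: "'a::real_normed_vector set \<Rightarrow> ('a \<Rightarrow> 'b::real_normed_vector) \<Rightarrow> bool" where
  "smooth_on S f \<longleftrightarrow> (\<forall>k. Ck_on k S f)"

section \<open>Manifolds\<close>

text \<open>
  A chart is a pair of its domain and its coordinate map; the values of the map outside the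
  domain are irrelevant. The topology of a manifold is the one induced by its atlas. The atlas
  need not be maximal.
\<close>

type_synonym ('m, 'e) chart = "'m set \<times> ('m \<Rightarrow> 'e)"

record ('m, 'e) manifold =
  points :: "'m set"
  charts :: "('m, 'e) chart set"

definition charts_at :: "('m, 'e) manifold \<Rightarrow> 'm \<Rightarrow> ('m, 'e) chart set" where
  "charts_at M x = {c \<in> charts M. x \<in> fst c}"

definition chart_inv :: "('m, 'e) chart \<Rightarrow> 'e \<Rightarrow> 'm" where
  "chart_inv c = inv_into (fst c) (snd c)"

definition transition :: "('m, 'e) chart \<Rightarrow> ('m, 'e) chart \<Rightarrow> 'e \<Rightarrow> 'e" where
  "transition c d = snd d \<circ> chart_inv c"

definition smooth_atlas :: "('m, 'e::real_normed_vector) manifold \<Rightarrow> bool" where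
  "smooth_atlas M \<longleftrightarrow>
     (\<Union>c\<in>charts M. fst c) = points M \<and>
     (\<forall>c\<in>charts M. inj_on (snd c) (fst c) \<and> open (snd c ` fst c)) \<and>
     (\<forall>c\<in>charts M. \<forall>d\<in>charts M.
        open (snd c ` (fst c \<inter> fst d)) \<and> smooth_on (snd c ` (fst c \<inter> fst d)) (transition c d))"

definition atlas_open :: "('m, 'e::topological_space) manifold \<Rightarrow> 'm set \<Rightarrow> bool" where
  "atlas_open M V \<longleftrightarrow> V \<subseteq> points M \<and> (\<forall>c\<in>charts M. open (snd c ` (fst c \<inter> V)))"

definition manifold_topology :: "('m, 'e::topological_space) manifold \<Rightarrow> 'm topology" where
  "manifold_topology M = topology (atlas_open M)"

lemma openin_manifold_topology:
  assumes "smooth_atlas M"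
  shows "openin (manifold_topology M) = atlas_open M"
proof -
  have "istopology (atlas_open M)"
    unfolding istopology_def
  proof (intro conjI allI impI)
    fix S T assume ST: "atlas_open M S" "atlas_open M T"
    have "open (snd c ` (fst c \<inter> (S \<inter> T)))" if c: "c \<in> charts M" for c
    proof -
      have "inj_on (snd c) (fst c)" using assms c by (auto simp: smooth_atlas_def)
      then have "snd c ` (fst c \<inter> (S \<inter> T)) = snd c ` (fst c \<inter> S) \<inter> snd c ` (fst c \<inter> T)"
        using inj_on_image_Int[of "snd c" "fst c" "fst c \<inter> S" "fst c \<inter> T"]
        by (simp add: Int_ac)
      then show ?thesis using ST c by (auto simp: atlas_open_def)
    qed
    then show "atlas_open M (S \<inter> T)" using ST by (auto simp: atlas_open_def)
  next
    fix K assume K: "\<forall>S\<in>K. atlas_open M S"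
    have "open (snd c ` (fst c \<inter> \<Union>K))" if c: "c \<in> charts M" for c
    proof -
      have "snd c ` (fst c \<inter> \<Union>K) = (\<Union>S\<in>K. snd c ` (fst c \<inter> S))" by auto
      then show ?thesis using K c by (auto simp: atlas_open_def)
    qed
    then show "atlas_open M (\<Union>K)" using K by (auto simp: atlas_open_def)
  qed
  then show ?thesis
    by (simp add: manifold_topology_def topology_inverse')
qed

definition smooth_manifold :: "nat \<Rightarrow> ('m, 'e::finite_dim_inner) manifold \<Rightarrow> bool" where
  "smooth_manifold n M \<longleftrightarrow>
     dim (UNIV :: 'e set) = n \<and> smooth_atlas M \<and>
     Hausdorff_space (manifold_topology M) \<and> second_countable (manifold_topology M)"

definition real_line :: "(real, real) manifold" where
  "real_line = \<lparr>points = UNIV, charts = {(UNIV, \<lambda>s. s)}\<rparr>"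

definition product_manifold ::
    "('m, 'e) manifold \<Rightarrow> ('k, 'f) manifold \<Rightarrow> ('m \<times> 'k, 'e \<times> 'f) manifold" where
  "product_manifold M N =
     \<lparr>points = points M \<times> points N,
      charts = {(fst c \<times> fst d, map_prod (snd c) (snd d)) | c d. c \<in> charts M \<and> d \<in> charts N}\<rparr>"

text \<open>The openness condition in the following definition expresses continuity.\<close>

definition smooth_map ::
    "('m, 'e::real_normed_vector) manifold \<Rightarrow> ('k, 'f::real_normed_vector) manifold \<Rightarrow>
     ('m \<Rightarrow> 'k) \<Rightarrow> bool" where
  "smooth_map M N F \<longleftrightarrow>
     F ` points M \<subseteq> points N \<and>
     (\<forall>c\<in>charts M. \<forall>d\<in>charts N.
        open (snd c ` (fst c \<inter> F -` fst d)) \<and>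
        smooth_on (snd c ` (fst c \<inter> F -` fst d)) (snd d \<circ> F \<circ> chart_inv c))"

definition diffeomorphism ::
    "('m, 'e::real_normed_vector) manifold \<Rightarrow> ('k, 'f::real_normed_vector) manifold \<Rightarrow>
     ('m \<Rightarrow> 'k) \<Rightarrow> bool" where
  "diffeomorphism M N F \<longleftrightarrow>
     bij_betw F (points M) (points N) \<and> smooth_map M N F \<and>
     smooth_map N M (inv_into (points M) F)"

section \<open>Tangent vectors and differential forms\<close>

text \<open>
  A tangent vector at \<open>x\<close> is an equivalence class of pairs of a chart at \<open>x\<close> and a coordinate
  vector: \<open>(c, v)\<close> and \<open>(d, w)\<close> are equivalent if the derivative at \<open>x\<close> of the change of
  coordinates from \<open>c\<close> to \<open>d\<close> maps \<open>v\<close> to \<open>w\<close>.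
\<close>

type_synonym ('m, 'e) tangent = "(('m, 'e) chart \<times> 'e) set"

definition tangent_vector ::
    "('m, 'e::real_normed_vector) manifold \<Rightarrow> 'm \<Rightarrow> ('m, 'e) chart \<Rightarrow> 'e \<Rightarrow> ('m, 'e) tangent" where
  "tangent_vector M x c v =
     {(d, w). d \<in> charts_at M x \<and> w = frechet_derivative (transition c d) (at (snd c x)) v}"

definition tangent_space ::
    "('m, 'e::real_normed_vector) manifold \<Rightarrow> 'm \<Rightarrow> ('m, 'e) tangent set" where
  "tangent_space M x = {tangent_vector M x c v | c v. c \<in> charts_at M x}"

definition coordinates :: "('m, 'e) chart \<Rightarrow> ('m, 'e) tangent \<Rightarrow> 'e" where
  "coordinates c X = (THE v. (c, v) \<in> X)"

definition differential ::
    "('m, 'e::real_normed_vector) manifold \<Rightarrow> ('k, 'f::real_normed_vector) manifold \<Rightarrow>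
     ('m \<Rightarrow> 'k) \<Rightarrow> 'm \<Rightarrow> ('m, 'e) tangent \<Rightarrow> ('k, 'f) tangent" where
  "differential M N F x X =
     {(d, frechet_derivative (snd d \<circ> F \<circ> chart_inv c) (at (snd c x)) v) | d c v.
        d \<in> charts_at N (F x) \<and> (c, v) \<in> X}"

text \<open>
  Differential forms are functions of a point and of tangent vectors at that point. Only their
  values at points of the manifold and on vectors of the tangent space there are meaningful,
  whence the notion of equality \<open>eq_2form\<close>.
\<close>

type_synonym ('m, 'e) form1 = "'m \<Rightarrow> ('m, 'e) tangent \<Rightarrow> real"
type_synonym ('m, 'e) form2 = "'m \<Rightarrow> ('m, 'e) tangent \<Rightarrow> ('m, 'e) tangent \<Rightarrow> real"

definition eq_2form ::
    "('m, 'e::real_normed_vector) manifold \<Rightarrow> ('m, 'e) form2 \<Rightarrow> ('m, 'e) form2 \<Rightarrow> bool" where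
  "eq_2form M \<alpha> \<beta> \<longleftrightarrow>
     (\<forall>x\<in>points M. \<forall>X\<in>tangent_space M x. \<forall>Y\<in>tangent_space M x. \<alpha> x X Y = \<beta> x X Y)"

text \<open>All representatives of a tangent vector give the same directional derivative.\<close>

definition d_fun :: "('m \<Rightarrow> real) \<Rightarrow> ('m, 'e::real_normed_vector) form1" where
  "d_fun f x X =
     the_elem ((\<lambda>(c, v). frechet_derivative (f \<circ> chart_inv c) (at (snd c x)) v) ` X)"

definition wedge :: "('m, 'e) form1 \<Rightarrow> ('m, 'e) form1 \<Rightarrow> ('m, 'e) form2" where
  "wedge \<alpha> \<beta> x X Y = \<alpha> x X * \<beta> x Y - \<alpha> x Y * \<beta> x X"

definition pullback ::
    "('m, 'e::real_normed_vector) manifold \<Rightarrow> ('k, 'f::real_normed_vector) manifold \<Rightarrow>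
     ('m \<Rightarrow> 'k) \<Rightarrow> ('k, 'f) form2 \<Rightarrow> ('m, 'e) form2" where
  "pullback M N F \<omega> x X Y = \<omega> (F x) (differential M N F x X) (differential M N F x Y)"

section \<open>The cotangent bundle\<close>

text \<open>
  The linear structure of the tangent space is the one transported from the model space by a
  chart; it does not depend on the chart.
\<close>

type_synonym ('m, 'e) cotangent = "('m, 'e) tangent \<Rightarrow> real"

definition cotangent_space ::
    "('m, 'e::real_normed_vector) manifold \<Rightarrow> 'm \<Rightarrow> ('m, 'e) cotangent set" where
  "cotangent_space M x =
     {p \<in> extensional (tangent_space M x).
        \<forall>c\<in>charts_at M x. linear (\<lambda>v. p (tangent_vector M x c v))}"

text \<open>
  In orthonormal coordinates \<open>q\<^sup>i\<close> on the model space, the components of \<open>momentum M c (q, p)\<close>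
  are the numbers \<open>p\<^sub>i = p (\<partial>/\<partial>q\<^sup>i)\<close>. Thus the charts of the cotangent bundle below are the
  canonical coordinates \<open>(q\<^sup>i, p\<^sub>i)\<close>.
\<close>

definition momentum ::
    "('m, 'e::real_inner) manifold \<Rightarrow> ('m, 'e) chart \<Rightarrow> 'm \<times> ('m, 'e) cotangent \<Rightarrow> 'e" where
  "momentum M c = (\<lambda>(q, p). THE w. \<forall>v. w \<bullet> v = p (tangent_vector M q c v))"

definition cotangent_chart ::
    "('m, 'e::real_inner) manifold \<Rightarrow> ('m, 'e) chart \<Rightarrow>
     ('m \<times> ('m, 'e) cotangent, 'e \<times> 'e) chart" where
  "cotangent_chart M c =
     (Sigma (fst c) (cotangent_space M), \<lambda>z. (snd c (fst z), momentum M c z))"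

definition cotangent_bundle ::
    "('m, 'e::real_inner) manifold \<Rightarrow> ('m \<times> ('m, 'e) cotangent, 'e \<times> 'e) manifold" where
  "cotangent_bundle M =
     \<lparr>points = Sigma (points M) (cotangent_space M), charts = cotangent_chart M ` charts M\<rparr>"

text \<open>
  The canonical symplectic form \<open>dp\<^sub>i \<and> dq\<^sup>i\<close>: if \<open>(x, \<xi>)\<close> and \<open>(y, \<eta>)\<close> are the canonical
  coordinates of \<open>X\<close> and \<open>Y\<close>, then the sum over \<open>i\<close> of \<open>dp\<^sub>i(X) dq\<^sup>i(Y) - dp\<^sub>i(Y) dq\<^sup>i(X)\<close> is
  \<open>\<xi> \<bullet> y - \<eta> \<bullet> x\<close>. The value is the same for all charts \<open>c\<close> at the base point, so that one of
  them may be chosen.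
\<close>

definition canonical_form ::
    "('m, 'e::real_inner) manifold \<Rightarrow> ('m \<times> ('m, 'e) cotangent, 'e \<times> 'e) form2" where
  "canonical_form M z X Y =
     (let c = (SOME c. c \<in> charts_at M (fst z));
          (x, \<xi>) = coordinates (cotangent_chart M c) X;
          (y, \<eta>) = coordinates (cotangent_chart M c) Y
      in \<xi> \<bullet> y - \<eta> \<bullet> x)"

section \<open>Extended phase space and canonical transformations\<close>

type_synonym ('q, 'e) phase_time_point = "('q \<times> ('q, 'e) cotangent) \<times> real"
type_synonym ('q, 'e) ext_phase_point = "('q \<times> real) \<times> ('q \<times> real, 'e \<times> real) cotangent"

definition phase_time ::
    "('q, 'e::real_inner) manifold \<Rightarrow> (('q, 'e) phase_time_point, ('e \<times> 'e) \<times> real) manifold" where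
  "phase_time Q = product_manifold (cotangent_bundle Q) real_line"

definition config_time ::
    "('q, 'e) manifold \<Rightarrow> ('q \<times> real, 'e \<times> real) manifold" where
  "config_time Q = product_manifold Q real_line"

definition ext_phase_space ::
    "('q, 'e::real_inner) manifold \<Rightarrow>
     (('q, 'e) ext_phase_point, ('e \<times> real) \<times> ('e \<times> real)) manifold" where
  "ext_phase_space Q = cotangent_bundle (config_time Q)"

text \<open>
  A covector \<open>P\<close> of \<open>Q \<times> \<real>\<close> at \<open>(q, t)\<close> corresponds to the pair \<open>(p, u)\<close> of its restriction \<open>p\<close> to
  the tangent space of \<open>Q\<close> at \<open>q\<close> and of its value \<open>u\<close> on \<open>\<partial>/\<partial>t\<close>. The tangent space of \<open>Q\<close> and
  the vector \<open>\<partial>/\<partial>t\<close> are pushed forward along the inclusions of the slices \<open>Q \<times> {t}\<close> and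
  \<open>{q} \<times> \<real>\<close>.
\<close>

definition proj_mu ::
    "('q, 'e::real_inner) manifold \<Rightarrow> ('q, 'e) ext_phase_point \<Rightarrow> ('q, 'e) phase_time_point" where
  "proj_mu Q = (\<lambda>((q, t), P).
     ((q, restrict (\<lambda>X. P (differential Q (config_time Q) (\<lambda>q'. (q', t)) q X)) (tangent_space Q q)), t))"

definition coord_u :: "('q, 'e::real_inner) manifold \<Rightarrow> ('q, 'e) ext_phase_point \<Rightarrow> real" where
  "coord_u Q = (\<lambda>((q, t), P).
     P (differential real_line (config_time Q) (\<lambda>s. (q, s)) t
          (tangent_vector real_line t (UNIV, \<lambda>s. s) 1)))"

definition time_pt :: "('q, 'e) phase_time_point \<Rightarrow> real" where
  "time_pt z = snd z"

definition time_ext :: "('q, 'e) ext_phase_point \<Rightarrow> real" where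
  "time_ext z = snd (fst z)"

text \<open>The forms \<open>\<omega>\<^sub>0\<close> pulled back to \<open>T\<^sup>*Q \<times> \<real>\<close> along the projection, and \<open>\<Omega>\<^sub>0\<close>.\<close>

definition omega_tilde ::
    "('q, 'e::real_inner) manifold \<Rightarrow> (('q, 'e) phase_time_point, ('e \<times> 'e) \<times> real) form2" where
  "omega_tilde Q = pullback (phase_time Q) (cotangent_bundle Q) fst (canonical_form Q)"

definition Omega_ext ::
    "('q, 'e::real_inner) manifold \<Rightarrow>
     (('q, 'e) ext_phase_point, ('e \<times> real) \<times> ('e \<times> real)) form2" where
  "Omega_ext Q =
     pullback (ext_phase_space Q) (phase_time Q) (proj_mu Q) (omega_tilde Q) +
     wedge (d_fun (coord_u Q)) (d_fun time_ext)"

definition canonical_transformation ::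
    "('q, 'e::real_inner) manifold \<Rightarrow>
     (('q, 'e) ext_phase_point \<Rightarrow> ('q, 'e) ext_phase_point) \<Rightarrow>
     (('q, 'e) phase_time_point \<Rightarrow> ('q, 'e) phase_time_point) \<Rightarrow> bool" where
  "canonical_transformation Q \<psi> \<phi> \<longleftrightarrow>
     diffeomorphism (ext_phase_space Q) (ext_phase_space Q) \<psi> \<and>
     diffeomorphism (phase_time Q) (phase_time Q) \<phi> \<and>
     (\<forall>z\<in>points (ext_phase_space Q). proj_mu Q (\<psi> z) = \<phi> (proj_mu Q z)) \<and>
     eq_2form (ext_phase_space Q)
       (pullback (ext_phase_space Q) (ext_phase_space Q) \<psi> (Omega_ext Q)) (Omega_ext Q)"

end

theory Submission
  imports Defs
begin

text \<open>
  Write \<open>E\<close> for the extended phase space, \<open>P\<close> for \<open>T\<^sup>*Q \<times> \<real>\<close>, and \<open>\<mu> : E \<rightarrow> P\<close> for the projection. If \<open>\<psi>\<close>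
  covers \<open>\<phi>\<close>, then \<open>t \<circ> \<psi> = t + h\<close>, so that \<open>d(t \<circ> \<psi>) = dt\<close> and
  \<open>\<psi>\<^sup>*\<Omega>\<^sub>0 - \<Omega>\<^sub>0 = \<mu>\<^sup>*(\<phi>\<^sup>*\<omega> - \<omega>) + d(u \<circ> \<psi> - u) \<and> dt\<close>,
  where \<open>\<omega>\<close> is the pullback of the canonical form to \<open>P\<close>. Everything follows from this identity.

  If \<open>u \<circ> \<psi> = u + W \<circ> \<mu>\<close>, the right-hand side is the pullback along \<open>\<mu>\<close> of \<open>\<phi>\<^sup>*\<omega> - \<omega> + dW \<and> dt\<close>, hence
  vanishes as soon as that form does (\<open>symplectic_if_pullback_omega_tilde\<close>). Such a \<open>\<psi>\<close> is a
  diffeomorphism because \<open>(m, u) \<mapsto> (\<phi>\<^sup>-\<^sup>1 m, u - W (\<phi>\<^sup>-\<^sup>1 m))\<close> inverts it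
  (\<open>diffeomorphism_psi\<close>).

  Conversely, suppose that \<open>\<psi>\<^sup>*\<Omega>\<^sub>0 = \<Omega>\<^sub>0\<close>. Insert into the identity the vector \<open>\<partial>/\<partial>u\<close>, which is killed by
  \<open>\<mu>\<close> and by \<open>dt\<close>, and a vector \<open>Y\<close> with \<open>dt(Y) = 1\<close>: this gives \<open>\<partial>(u \<circ> \<psi>)/\<partial>u = 1\<close>
  (\<open>fibre_derivative\<close>). As the fibres of \<open>\<mu>\<close> are lines, \<open>u \<circ> \<psi> - u\<close> is constant on each of them
  and equals \<open>W \<circ> \<mu>\<close> with \<open>W\<close> the restriction of \<open>u \<circ> \<psi>\<close> to the section \<open>u = 0\<close> (\<open>coord_u_psi\<close>).
  Pulling the identity back along that section gives the formula for \<open>\<phi>\<^sup>*\<omega>\<close>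
  (\<open>pullback_omega_tilde\<close>).

  This argument is free of coordinates. It uses the chain rule for differentials of smooth maps, the
  fact that \<open>\<omega>\<close> vanishes if one argument is zero, and the identification \<open>E \<cong> P \<times> \<real>\<close> given by
  \<open>(\<mu>, u)\<close>, whose smooth inverse is \<open>ext_point\<close>. Charts enter only to establish these: the atlases
  of products and cotangent bundles are shown to be smooth, and in canonical coordinates
  \<open>(\<mu>, u)\<close> merely permutes \<open>((x, t), (\<xi>, u))\<close> into \<open>(((x, \<xi>), t), u)\<close>.
\<close>

section \<open>Smooth functions on open sets\<close>

lemma orthonormal_expansion:
  "\<exists>B :: 'a::finite_dim_inner set. finite B \<and> (\<forall>x. (\<Sum>b\<in>B. (x \<bullet> b) *\<^sub>R b) = x)"
proof -
  obtain B :: "'a set" where "finite B \<and>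
      (\<forall>x\<in>B. \<forall>y\<in>B. x \<bullet> y = (if x = y then 1 else 0)) \<and> (\<forall>x. (\<forall>y\<in>B. x \<bullet> y = 0) \<longrightarrow> x = 0)"
    using finite_orthonormal_basis ..
  then have B: "finite B" "\<And>x y. x \<in> B \<Longrightarrow> y \<in> B \<Longrightarrow> x \<bullet> y = (if x = y then 1 else 0)"
      "\<And>x. (\<forall>y\<in>B. x \<bullet> y = 0) \<Longrightarrow> x = 0"
    by auto
  have "(\<Sum>b\<in>B. (x \<bullet> b) *\<^sub>R b) = x" for x
  proof -
    have "(x - (\<Sum>b\<in>B. (x \<bullet> b) *\<^sub>R b)) \<bullet> y = 0" if "y \<in> B" for y
    proof -
      have "(\<Sum>b\<in>B. (x \<bullet> b) * (b \<bullet> y)) = (\<Sum>b\<in>B. if b = y then x \<bullet> b else 0)"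
        using B(2) that by (intro sum.cong) auto
      also have "\<dots> = x \<bullet> y" using B(1) that by simp
      finally show ?thesis by (simp add: inner_diff_left inner_sum_left)
    qed
    then have "x - (\<Sum>b\<in>B. (x \<bullet> b) *\<^sub>R b) = 0" using B(3) by blast
    then show ?thesis by simp
  qed
  with B(1) show ?thesis by blast
qed

text \<open>
  Derivatives only see a neighbourhood of the point. This is used throughout because coordinate
  expressions such as \<open>snd d \<circ> F \<circ> chart_inv c\<close> are meaningful only on part of the model space.
\<close>

lemma has_derivative_cong_open:
  assumes "open S" "x \<in> S" "\<And>y. y \<in> S \<Longrightarrow> f y = g y"
  shows "(f has_derivative D) (at x) \<longleftrightarrow> (g has_derivative D) (at x)"
  using has_derivative_transform_within_open[of f D x UNIV S g]
    has_derivative_transform_within_open[of g D x UNIV S f] assms by auto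

lemma frechet_derivative_cong_open:
  assumes "open S" "x \<in> S" "\<And>y. y \<in> S \<Longrightarrow> f y = g y"
  shows "frechet_derivative f (at x) = frechet_derivative g (at x)"
  by (simp add: frechet_derivative_def has_derivative_cong_open[OF assms])

lemma differentiable_cong_open:
  assumes "open S" "x \<in> S" "\<And>y. y \<in> S \<Longrightarrow> f y = g y"
  shows "f differentiable (at x) \<longleftrightarrow> g differentiable (at x)"
  by (simp add: differentiable_def has_derivative_cong_open[OF assms])

lemma frechet_derivativeI: "(f has_derivative D) (at x) \<Longrightarrow> frechet_derivative f (at x) = D"
  by (rule frechet_derivative_at[symmetric])

lemma Ck_on_cong:
  assumes "open S"
  shows "(\<And>y. y \<in> S \<Longrightarrow> f y = g y) \<Longrightarrow> Ck_on k S f \<longleftrightarrow> Ck_on k S g"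
proof (induction k arbitrary: f g)
  case 0
  then show ?case by (simp cong: continuous_on_cong)
next
  case (Suc k)
  have "frechet_derivative f (at x) v = frechet_derivative g (at x) v" if "x \<in> S" for x v
    using frechet_derivative_cong_open[OF assms that Suc.prems] by simp
  then have "Ck_on k S (\<lambda>x. frechet_derivative f (at x) v) \<longleftrightarrow>
      Ck_on k S (\<lambda>x. frechet_derivative g (at x) v)" for v
    by (rule Suc.IH)
  then show ?case using differentiable_cong_open[OF assms _ Suc.prems] by simp
qed

lemma Ck_on_Suc_lower: "Ck_on (Suc k) S f \<Longrightarrow> Ck_on k S f"
proof (induction k arbitrary: f)
  case 0
  then show ?case
    by (auto intro!: continuous_at_imp_continuous_on differentiable_imp_continuous_within)
next
  case (Suc k)
  then show ?case by (metis Ck_on.simps(2))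
qed

text \<open>
  As \<open>S\<close> is open, it is enough to know a formula for the derivative that holds on \<open>S\<close>.
\<close>

lemma Ck_on_SucI:
  assumes "open S" "\<And>x. x \<in> S \<Longrightarrow> (f has_derivative D x) (at x)" "\<And>v. Ck_on k S (\<lambda>x. D x v)"
  shows "Ck_on (Suc k) S f"
proof -
  have "Ck_on k S (\<lambda>x. frechet_derivative f (at x) v)" for v
    using Ck_on_cong[OF assms(1), of "\<lambda>x. frechet_derivative f (at x) v" "\<lambda>x. D x v"]
      assms(3) frechet_derivativeI[OF assms(2)] by simp
  then show ?thesis using assms(2) by (auto simp: differentiable_def)
qed

lemma Ck_on_SucD:
  assumes "Ck_on (Suc k) S f"
  shows "x \<in> S \<Longrightarrow> (f has_derivative frechet_derivative f (at x)) (at x)"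
    and "Ck_on k S (\<lambda>x. frechet_derivative f (at x) v)"
  using assms by (auto simp: frechet_derivative_works[symmetric])

lemma Ck_on_const: "Ck_on k S (\<lambda>x. c)"
  by (induction k arbitrary: c) auto

lemma Ck_on_add:
  assumes "open S"
  shows "Ck_on k S f \<Longrightarrow> Ck_on k S g \<Longrightarrow> Ck_on k S (\<lambda>x. f x + g x)"
proof (induction k arbitrary: f g)
  case 0
  then show ?case by (auto intro: continuous_on_add)
next
  case (Suc k)
  show ?case
    by (rule Ck_on_SucI[OF assms has_derivative_add[OF Ck_on_SucD(1) Ck_on_SucD(1)]])
      (use Suc.prems in blast, use Suc.prems in blast, use Suc.prems in blast,
       use Suc.prems in blast, intro Suc.IH Ck_on_SucD(2) Suc.prems)
qed

lemma Ck_on_sum: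
  assumes "open S" "\<And>i. i \<in> I \<Longrightarrow> Ck_on k S (f i)"
  shows "Ck_on k S (\<lambda>x. \<Sum>i\<in>I. f i x)"
  using assms(2) by (induction I rule: infinite_finite_induct)
    (auto simp: Ck_on_const intro: Ck_on_add[OF assms(1)])

lemma Ck_on_bounded_linear:
  assumes "bounded_linear L" "open S"
  shows "Ck_on k S f \<Longrightarrow> Ck_on k S (\<lambda>x. L (f x))"
proof (induction k arbitrary: f)
  case 0
  then show ?case using bounded_linear.continuous_on[OF assms(1)] by auto
next
  case (Suc k)
  show ?case
    by (rule Ck_on_SucI[OF assms(2) bounded_linear.has_derivative[OF assms(1) Ck_on_SucD(1)]])
      (use Suc.prems in blast, use Suc.prems in blast, intro Suc.IH Ck_on_SucD(2) Suc.prems)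
qed

lemma Ck_on_bounded_bilinear:
  assumes "bounded_bilinear B" "open S"
  shows "Ck_on k S f \<Longrightarrow> Ck_on k S g \<Longrightarrow> Ck_on k S (\<lambda>x. B (f x) (g x))"
proof (induction k arbitrary: f g)
  case 0
  then show ?case using bounded_bilinear.continuous_on[OF assms(1)] by auto
next
  case (Suc k)
  note low = Suc.prems[THEN Ck_on_Suc_lower]
  show ?case
    by (rule Ck_on_SucI[OF assms(2) bounded_bilinear.FDERIV[OF assms(1) Ck_on_SucD(1) Ck_on_SucD(1)]])
      (use Suc.prems in blast,
       use Suc.prems in blast,
       use Suc.prems in blast,
       use Suc.prems in blast,
       intro Ck_on_add assms Suc.IH low Ck_on_SucD(2) Suc.prems)
qed

lemma Ck_on_Pair:
  assumes "open S"
  shows "Ck_on k S f \<Longrightarrow> Ck_on k S g \<Longrightarrow> Ck_on k S (\<lambda>x. (f x, g x))"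
proof (induction k arbitrary: f g)
  case 0
  then show ?case by (auto intro: continuous_on_Pair)
next
  case (Suc k)
  show ?case
    by (rule Ck_on_SucI[OF assms has_derivative_Pair[OF Ck_on_SucD(1) Ck_on_SucD(1)]])
      (use Suc.prems in blast, use Suc.prems in blast, use Suc.prems in blast,
       use Suc.prems in blast, intro Suc.IH Ck_on_SucD(2) Suc.prems)
qed

text \<open>
  The chain rule expresses the derivative of \<open>g \<circ> f\<close> in a fixed direction through the derivative of
  \<open>g\<close> in the varying direction \<open>Df(x)v\<close>, whereas the class \<open>C\<^sup>k\<close> only speaks of fixed directions.
  Expanding \<open>Df(x)v\<close> in an orthonormal basis of the middle space reduces to fixed directions; this is
  where finite dimension enters.
\<close>

lemma Ck_on_compose:
  fixes f :: "'a::real_normed_vector \<Rightarrow> 'b::finite_dim_inner"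
    and g :: "'b \<Rightarrow> 'c::real_normed_vector"
  assumes "open S" "f ` S \<subseteq> T"
  shows "Ck_on k S f \<Longrightarrow> Ck_on k T g \<Longrightarrow> Ck_on k S (\<lambda>x. g (f x))"
proof (induction k arbitrary: g)
  case 0
  then show ?case using assms continuous_on_compose2 by auto
next
  case (Suc k)
  obtain B :: "'b set" where B: "finite B" "\<And>x. (\<Sum>b\<in>B. (x \<bullet> b) *\<^sub>R b) = x"
    using orthonormal_expansion by blast
  let ?Df = "\<lambda>x. frechet_derivative f (at x)"
  let ?Dg = "\<lambda>y. frechet_derivative g (at y)"
  show ?case
  proof (rule Ck_on_SucI[OF assms(1)])
    fix x assume x: "x \<in> S"
    have f: "(f has_derivative ?Df x) (at x)" and g: "(g has_derivative ?Dg (f x)) (at (f x))"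
      using Ck_on_SucD(1)[OF Suc.prems(1) x] Ck_on_SucD(1)[OF Suc.prems(2)] x assms(2) by blast+
    have expand: "?Dg (f x) w = (\<Sum>b\<in>B. (w \<bullet> b) *\<^sub>R ?Dg (f x) b)" for w
    proof -
      have lin: "linear (?Dg (f x))" using g by (rule has_derivative_linear)
      have "?Dg (f x) w = ?Dg (f x) (\<Sum>b\<in>B. (w \<bullet> b) *\<^sub>R b)" using B(2)[of w] by simp
      also have "\<dots> = (\<Sum>b\<in>B. (w \<bullet> b) *\<^sub>R ?Dg (f x) b)"
        by (simp add: linear_sum[OF lin] linear_cmul[OF lin])
      finally show ?thesis .
    qed
    have "((\<lambda>x. g (f x)) has_derivative (\<lambda>v. ?Dg (f x) (?Df x v))) (at x)"
      using diff_chain_at[OF f g] by (simp add: o_def)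
    moreover have "(\<lambda>v. ?Dg (f x) (?Df x v)) = (\<lambda>v. \<Sum>b\<in>B. (?Df x v \<bullet> b) *\<^sub>R ?Dg (f x) b)"
      by (intro ext expand)
    ultimately show "((\<lambda>x. g (f x)) has_derivative
        (\<lambda>v. \<Sum>b\<in>B. (?Df x v \<bullet> b) *\<^sub>R ?Dg (f x) b)) (at x)"
      by (rule back_subst[where P="\<lambda>D. (_ has_derivative D) _"])
  next
    fix v
    have "Ck_on k S (\<lambda>x. ?Dg (f x) b)" for b
      by (rule Suc.IH[OF Ck_on_Suc_lower[OF Suc.prems(1)] Ck_on_SucD(2)[OF Suc.prems(2)]])
    moreover have "Ck_on k S (\<lambda>x. ?Df x v \<bullet> b)" for b
      by (rule Ck_on_bounded_linear[OF bounded_linear_inner_left assms(1) Ck_on_SucD(2)])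
        (rule Suc.prems)
    ultimately show "Ck_on k S (\<lambda>x. \<Sum>b\<in>B. (?Df x v \<bullet> b) *\<^sub>R ?Dg (f x) b)"
      by (intro Ck_on_sum Ck_on_bounded_bilinear[OF bounded_bilinear_scaleR] assms(1))
  qed
qed

lemma Ck_on_local:
  assumes "\<And>x. x \<in> S \<Longrightarrow> \<exists>V. open V \<and> x \<in> V \<and> Ck_on k V f"
  shows "Ck_on k S f"
  using assms
proof (induction k arbitrary: f)
  case 0
  then show ?case
    by (force intro!: continuous_at_imp_continuous_on simp: continuous_on_eq_continuous_at)
next
  case (Suc k)
  have "f differentiable (at x)" if "x \<in> S" for x
    using Suc.prems[OF that] by auto
  moreover have "Ck_on k S (\<lambda>x. frechet_derivative f (at x) v)" for v
    using Suc.prems by (intro Suc.IH) (metis Ck_on.simps(2))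
  ultimately show ?case by simp
qed

lemma smooth_on_const: "smooth_on S (\<lambda>x. c)"
  by (simp add: smooth_on_def Ck_on_const)

lemma smooth_on_bounded_linear: "bounded_linear L \<Longrightarrow> open S \<Longrightarrow> smooth_on S f \<Longrightarrow> smooth_on S (\<lambda>x. L (f x))"
  by (simp add: smooth_on_def Ck_on_bounded_linear)

lemma smooth_on_id: "smooth_on S (\<lambda>x. x)"
proof -
  have "Ck_on k S (\<lambda>x. x)" for k
    by (cases k) (simp_all add: Ck_on_const)
  then show ?thesis by (simp add: smooth_on_def)
qed

lemma smooth_on_linear: "bounded_linear L \<Longrightarrow> open S \<Longrightarrow> smooth_on S L"
  using smooth_on_bounded_linear[OF _ _ smooth_on_id] .

lemma smooth_on_Pair: "open S \<Longrightarrow> smooth_on S f \<Longrightarrow> smooth_on S g \<Longrightarrow> smooth_on S (\<lambda>x. (f x, g x))"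
  by (simp add: smooth_on_def Ck_on_Pair)

lemma smooth_on_sum:
  "open S \<Longrightarrow> (\<And>i. i \<in> I \<Longrightarrow> smooth_on S (f i)) \<Longrightarrow> smooth_on S (\<lambda>x. \<Sum>i\<in>I. f i x)"
  by (simp add: smooth_on_def Ck_on_sum)

lemma smooth_on_bounded_bilinear:
  "bounded_bilinear B \<Longrightarrow> open S \<Longrightarrow> smooth_on S f \<Longrightarrow> smooth_on S g \<Longrightarrow> smooth_on S (\<lambda>x. B (f x) (g x))"
  by (simp add: smooth_on_def Ck_on_bounded_bilinear)

lemma smooth_on_compose:
  fixes f :: "'a::real_normed_vector \<Rightarrow> 'b::finite_dim_inner"
  assumes "open S" "f ` S \<subseteq> T" "smooth_on S f" "smooth_on T g"
  shows "smooth_on S (\<lambda>x. g (f x))"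
  using assms by (simp add: smooth_on_def Ck_on_compose)

lemma smooth_on_cong: "open S \<Longrightarrow> (\<And>y. y \<in> S \<Longrightarrow> f y = g y) \<Longrightarrow> smooth_on S f \<longleftrightarrow> smooth_on S g"
  using Ck_on_cong[of S f g] by (simp add: smooth_on_def)

lemma smooth_on_local:
  assumes "\<And>x. x \<in> S \<Longrightarrow> \<exists>V. open V \<and> x \<in> V \<and> smooth_on V f"
  shows "smooth_on S f"
  unfolding smooth_on_def using assms by (meson Ck_on_local smooth_on_def)

lemma smooth_on_subset:
  assumes "smooth_on S f" "T \<subseteq> S" shows "smooth_on T f"
proof -
  have "Ck_on k S f \<Longrightarrow> Ck_on k T f" for k
    using assms(2) by (induction k arbitrary: f) (auto intro: continuous_on_subset)
  then show ?thesis using assms(1) by (simp add: smooth_on_def)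
qed

lemma smooth_on_imp_continuous_on: "smooth_on S f \<Longrightarrow> continuous_on S f"
  unfolding smooth_on_def by (metis Ck_on.simps(1))

lemma smooth_on_has_derivative:
  "smooth_on S f \<Longrightarrow> x \<in> S \<Longrightarrow> (f has_derivative frechet_derivative f (at x)) (at x)"
  unfolding smooth_on_def by (metis Ck_on_SucD(1))

lemma smooth_on_frechet_derivative:
  "smooth_on S f \<Longrightarrow> smooth_on S (\<lambda>x. frechet_derivative f (at x) v)"
  unfolding smooth_on_def by (metis Ck_on.simps(2))

section \<open>Charts and smooth maps\<close>

text \<open>
  Charts are pairs. They are treated as opaque, since splitting them into a domain and a map only
  obscures the statements.
\<close>

declare split_paired_Ex [simp del] split_paired_All [simp del]

lemma charts_at_iff: "c \<in> charts_at M x \<longleftrightarrow> c \<in> charts M \<and> x \<in> fst c"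
  by (simp add: charts_at_def)

lemma chart_subset_points: "smooth_atlas M \<Longrightarrow> c \<in> charts M \<Longrightarrow> x \<in> fst c \<Longrightarrow> x \<in> points M"
  by (auto simp: smooth_atlas_def)

lemma charts_at_point: "smooth_atlas M \<Longrightarrow> c \<in> charts_at M x \<Longrightarrow> x \<in> points M"
  unfolding charts_at_iff by (elim conjE) (rule chart_subset_points)

lemma exists_chart_at:
  assumes "smooth_atlas M" "x \<in> points M"
  obtains c where "c \<in> charts_at M x"
proof -
  have "x \<in> (\<Union>c\<in>charts M. fst c)" using assms by (simp add: smooth_atlas_def)
  then show ?thesis using that by (auto simp: charts_at_def)
qed

lemma chart_inj: "smooth_atlas M \<Longrightarrow> c \<in> charts M \<Longrightarrow> inj_on (snd c) (fst c)"
  by (simp add: smooth_atlas_def)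

lemma chart_eqD:
  "smooth_atlas M \<Longrightarrow> c \<in> charts M \<Longrightarrow> x \<in> fst c \<Longrightarrow> y \<in> fst c \<Longrightarrow> snd c x = snd c y \<Longrightarrow> x = y"
  by (rule inj_onD[OF chart_inj])

lemma open_chart_image: "smooth_atlas M \<Longrightarrow> c \<in> charts M \<Longrightarrow> open (snd c ` fst c)"
  by (simp add: smooth_atlas_def)

lemma chart_inv_chart: "smooth_atlas M \<Longrightarrow> c \<in> charts M \<Longrightarrow> x \<in> fst c \<Longrightarrow> chart_inv c (snd c x) = x"
  by (simp add: chart_inv_def inv_into_f_f chart_inj)

lemma transition_chart:
  "smooth_atlas M \<Longrightarrow> c \<in> charts M \<Longrightarrow> x \<in> fst c \<Longrightarrow> transition c d (snd c x) = snd d x"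
  by (simp add: transition_def chart_inv_chart)

definition smooth_at ::
    "('m, 'e::real_normed_vector) manifold \<Rightarrow> ('k, 'f::real_normed_vector) manifold \<Rightarrow> ('m \<Rightarrow> 'k) \<Rightarrow> 'm \<Rightarrow> bool"
  where
  "smooth_at M N F x \<longleftrightarrow> (\<exists>c\<in>charts_at M x. \<exists>d\<in>charts N. \<exists>U L.
      open U \<and> snd c x \<in> U \<and> smooth_on U L \<and>
      (\<forall>y\<in>fst c. snd c y \<in> U \<longrightarrow> F y \<in> fst d \<and> snd d (F y) = L (snd c y)))"

lemma smooth_atI:
  assumes "c \<in> charts_at M x" "d \<in> charts_at N y" "open U" "snd c x \<in> U" "smooth_on U L"
    "\<And>y. y \<in> fst c \<Longrightarrow> snd c y \<in> U \<Longrightarrow> F y \<in> fst d"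
    "\<And>y. y \<in> fst c \<Longrightarrow> snd c y \<in> U \<Longrightarrow> snd d (F y) = L (snd c y)"
  shows "smooth_at M N F x"
  unfolding smooth_at_def
proof (intro bexI exI conjI ballI impI)
  show "c \<in> charts_at M x" "d \<in> charts N" "open U" "snd c x \<in> U" "smooth_on U L"
    using assms by (simp_all add: charts_at_iff)
qed (use assms(6,7) in simp_all)

text \<open>
  A map of manifolds is smooth if near each point some pair of charts gives it a smooth coordinate
  expression: in any other pair of charts the expression is composed with transition maps on both
  sides. The coordinate expression is described by its values on points instead of through
  \<open>chart_inv\<close>, which makes the criterion easy to apply and to compose.
\<close>

lemma smooth_mapI:
  fixes M :: "('m, 'e::finite_dim_inner) manifold" and N :: "('k, 'f::finite_dim_inner) manifold"
  assumes M: "smooth_atlas M" and N: "smooth_atlas N"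
    and "\<And>x. x \<in> points M \<Longrightarrow> smooth_at M N F x"
  shows "smooth_map M N F"
proof -
  have loc: "\<exists>c d U L. c \<in> charts M \<and> x \<in> fst c \<and> d \<in> charts N \<and> open U \<and> snd c x \<in> U \<and> smooth_on U L \<and>
      (\<forall>y\<in>fst c. snd c y \<in> U \<longrightarrow> F y \<in> fst d \<and> snd d (F y) = L (snd c y))"
    if "x \<in> points M" for x
    using assms(3)[OF that] unfolding smooth_at_def charts_at_iff Bex_def by (elim exE conjE) (intro exI conjI)
  have pts: "F x \<in> points N" if x: "x \<in> points M" for x
    using loc[OF x] chart_subset_points[OF N] by metis
  have *: "open S \<and> smooth_on S (snd d' \<circ> F \<circ> chart_inv c')"
    if c': "c' \<in> charts M" and d': "d' \<in> charts N" and S: "S = snd c' ` (fst c' \<inter> F -` fst d')"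
    for c' d' S
  proof -
    have *: "\<exists>V. open V \<and> s \<in> V \<and> V \<subseteq> S \<and> smooth_on V (snd d' \<circ> F \<circ> chart_inv c')" if s: "s \<in> S" for s
    proof -
      obtain x where x: "s = snd c' x" "x \<in> fst c'" "F x \<in> fst d'" using s S by auto
      obtain c d U L where c: "c \<in> charts M" "x \<in> fst c" and d: "d \<in> charts N"
        and U: "open U" "snd c x \<in> U" and L: "smooth_on U L"
        and FL: "\<And>y. y \<in> fst c \<Longrightarrow> snd c y \<in> U \<Longrightarrow> F y \<in> fst d \<and> snd d (F y) = L (snd c y)"
        using loc[OF chart_subset_points[OF M c' x(2)]] by metis
      define A where "A = snd c' ` (fst c' \<inter> fst c)"
      define B where "B = snd d ` (fst d \<inter> fst d')"
      have A: "open A" "smooth_on A (transition c' c)"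
        using M c c' by (auto simp: smooth_atlas_def A_def)
      have B: "open B" "smooth_on B (transition d d')"
        using N d d' by (auto simp: smooth_atlas_def B_def)
      define A' where "A' = A \<inter> transition c' c -` U"
      have A': "open A'" unfolding A'_def
        by (rule continuous_open_preimage[OF smooth_on_imp_continuous_on[OF A(2)] A(1) U(1)])
      have sA': "smooth_on A' (\<lambda>y. L (transition c' c y))"
        by (rule smooth_on_compose[OF A' _ smooth_on_subset[OF A(2)] L]) (auto simp: A'_def)
      define V where "V = A' \<inter> (\<lambda>y. L (transition c' c y)) -` B"
      have V: "open V" unfolding V_def
        by (rule continuous_open_preimage[OF smooth_on_imp_continuous_on[OF sA'] A' B(1)])
      have sV: "smooth_on V (\<lambda>y. transition d d' (L (transition c' c y)))"
        by (rule smooth_on_compose[OF V _ smooth_on_subset[OF sA'] B(2)]) (auto simp: V_def)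
      \<comment> \<open>\<open>V\<close> is where the given coordinate expression \<open>L\<close>, sandwiched between transition maps, makes sense.\<close>
      have VF: "y \<in> S \<and> (snd d' \<circ> F \<circ> chart_inv c') y = transition d d' (L (transition c' c y))"
        if y: "y \<in> V" for y
      proof -
        from y obtain w where w: "y = snd c' w" "w \<in> fst c'" "w \<in> fst c"
          by (auto simp: V_def A'_def A_def)
        have t: "transition c' c y = snd c w" using w c' M by (simp add: transition_chart)
        then have wU: "snd c w \<in> U" and LB: "L (snd c w) \<in> B" using y by (auto simp: V_def A'_def)
        note F = FL[OF w(3) wU]
        obtain b where b: "L (snd c w) = snd d b" "b \<in> fst d" "b \<in> fst d'" using LB by (auto simp: B_def)
        have "F w = b" using chart_eqD[OF N d, of "F w" b] F b by simp
        then have "F w \<in> fst d'" using b by simp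
        then show ?thesis
          using w S t F transition_chart[OF N d, of "F w" d'] chart_inv_chart[OF M c' w(2)] by auto
      qed
      have "transition c' c s = snd c x" using transition_chart[OF M c' x(2), of c] x by simp
      moreover have "snd d (F x) = L (snd c x)" "F x \<in> fst d" using FL[OF c(2) U(2)] by auto
      moreover have "s \<in> A" unfolding A_def using x c by blast
      moreover have "snd d (F x) \<in> B" unfolding B_def using x \<open>F x \<in> fst d\<close> by blast
      ultimately have "s \<in> V" using U by (simp add: V_def A'_def)
      moreover have "V \<subseteq> S" using VF by blast
      moreover have "smooth_on V (snd d' \<circ> F \<circ> chart_inv c')"
        by (rule iffD2[OF smooth_on_cong[OF V] sV]) (use VF in blast)
      ultimately show ?thesis using V by blast
    qed
    then have "open S" by (meson open_subopen)
    moreover have "smooth_on S (snd d' \<circ> F \<circ> chart_inv c')"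
      using * by (intro smooth_on_local) blast
    ultimately show ?thesis by blast
  qed
  show ?thesis unfolding smooth_map_def using pts * by blast
qed

lemma smooth_map_open_smooth:
  assumes "smooth_map M N F" "c \<in> charts M" "d \<in> charts N"
  shows "open (snd c ` (fst c \<inter> F -` fst d))"
    and "smooth_on (snd c ` (fst c \<inter> F -` fst d)) (snd d \<circ> F \<circ> chart_inv c)"
  using assms by (auto simp: smooth_map_def)

lemma smooth_mapE:
  assumes M: "smooth_atlas M" and F: "smooth_map M N F"
    and c: "c \<in> charts_at M x" and d: "d \<in> charts_at N (F x)"
  obtains U L where "open U" "snd c x \<in> U" "smooth_on U L"
    "\<And>y. y \<in> fst c \<Longrightarrow> snd c y \<in> U \<Longrightarrow> F y \<in> fst d \<and> snd d (F y) = L (snd c y)"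
proof
  let ?U = "snd c ` (fst c \<inter> F -` fst d)" and ?L = "snd d \<circ> F \<circ> chart_inv c"
  show "open ?U" "smooth_on ?U ?L"
    using smooth_map_open_smooth[OF F] c d by (auto simp: charts_at_iff)
  show "snd c x \<in> ?U" using c d by (auto simp: charts_at_iff)
  fix y assume y: "y \<in> fst c" "snd c y \<in> ?U"
  then obtain z where "z \<in> fst c" "F z \<in> fst d" "snd c y = snd c z" by auto
  then have "F y \<in> fst d" using chart_eqD[OF M, of c y z] y c by (auto simp: charts_at_iff)
  then show "F y \<in> fst d \<and> snd d (F y) = ?L (snd c y)"
    using y c by (simp add: charts_at_iff chart_inv_chart[OF M])
qed

lemma smooth_map_point: "smooth_map M N F \<Longrightarrow> x \<in> points M \<Longrightarrow> F x \<in> points N"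
  by (auto simp: smooth_map_def)

lemma smooth_map_cong:
  fixes M :: "('m, 'e::finite_dim_inner) manifold" and N :: "('k, 'f::finite_dim_inner) manifold"
  assumes M: "smooth_atlas M" and N: "smooth_atlas N" and F: "smooth_map M N F"
    and eq: "\<And>x. x \<in> points M \<Longrightarrow> F x = G x"
  shows "smooth_map M N G"
proof (rule smooth_mapI[OF M N])
  fix x assume x: "x \<in> points M"
  obtain c where c: "c \<in> charts_at M x" using exists_chart_at[OF M x] .
  obtain d where d: "d \<in> charts_at N (F x)" using exists_chart_at[OF N smooth_map_point[OF F x]] .
  have "F y = G y" if "y \<in> fst c" for y
    using eq chart_subset_points[OF M _ that] c by (simp add: charts_at_iff)
  moreover obtain U L where "open U" "snd c x \<in> U" "smooth_on U L"
    "\<And>y. y \<in> fst c \<Longrightarrow> snd c y \<in> U \<Longrightarrow> F y \<in> fst d \<and> snd d (F y) = L (snd c y)"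
    using smooth_mapE[OF M F c d] by metis
  ultimately show "smooth_at M N G x"
    using smooth_atI[OF c d, of U L G] by metis
qed

lemma smooth_map_compose:
  fixes M :: "('m, 'e::finite_dim_inner) manifold" and N :: "('k, 'f::finite_dim_inner) manifold"
    and K :: "('l, 'g::finite_dim_inner) manifold"
  assumes M: "smooth_atlas M" and N: "smooth_atlas N" and K: "smooth_atlas K"
    and F: "smooth_map M N F" and G: "smooth_map N K G"
  shows "smooth_map M K (\<lambda>x. G (F x))"
proof (rule smooth_mapI[OF M K])
  fix x assume x: "x \<in> points M"
  note Fx = smooth_map_point[OF F x]
  obtain c where c: "c \<in> charts_at M x" using exists_chart_at[OF M x] .
  obtain d where d: "d \<in> charts_at N (F x)" using exists_chart_at[OF N Fx] .
  obtain e where e: "e \<in> charts_at K (G (F x))" using exists_chart_at[OF K smooth_map_point[OF G Fx]] .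
  obtain U L where U: "open U" "snd c x \<in> U" "smooth_on U L"
    and UL: "\<And>y. y \<in> fst c \<Longrightarrow> snd c y \<in> U \<Longrightarrow> F y \<in> fst d \<and> snd d (F y) = L (snd c y)"
    using smooth_mapE[OF M F c d] by metis
  obtain U' L' where U': "open U'" "snd d (F x) \<in> U'" "smooth_on U' L'"
    and UL': "\<And>y. y \<in> fst d \<Longrightarrow> snd d y \<in> U' \<Longrightarrow> G y \<in> fst e \<and> snd e (G y) = L' (snd d y)"
    using smooth_mapE[OF N G d e] by metis
  define V where "V = U \<inter> L -` U'"
  have V: "open V" unfolding V_def
    by (rule continuous_open_preimage[OF smooth_on_imp_continuous_on[OF U(3)] U(1) U'(1)])
  have "smooth_on V (\<lambda>y. L' (L y))"
    by (rule smooth_on_compose[OF V _ smooth_on_subset[OF U(3)] U'(3)]) (auto simp: V_def)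
  moreover have "snd c x \<in> V" using U U' UL[of x] c by (simp add: V_def charts_at_iff)
  moreover have "\<forall>y\<in>fst c. snd c y \<in> V \<longrightarrow> G (F y) \<in> fst e \<and> snd e (G (F y)) = L' (L (snd c y))"
    using UL UL' by (auto simp: V_def)
  ultimately show "smooth_at M K (\<lambda>x. G (F x)) x"
    using smooth_atI[OF c e V, of "\<lambda>y. L' (L y)" "\<lambda>x. G (F x)"] by blast
qed

lemma smooth_map_const:
  fixes M :: "('m, 'e::finite_dim_inner) manifold" and N :: "('k, 'f::finite_dim_inner) manifold"
  assumes M: "smooth_atlas M" and N: "smooth_atlas N" and y: "y \<in> points N"
  shows "smooth_map M N (\<lambda>x. y)"
proof (rule smooth_mapI[OF M N])
  fix x assume x: "x \<in> points M"
  obtain c where c: "c \<in> charts_at M x" using exists_chart_at[OF M x] .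
  obtain d where d: "d \<in> charts_at N y" using exists_chart_at[OF N y] .
  show "smooth_at M N (\<lambda>x. y) x"
    by (rule smooth_atI[OF c d, of UNIV "\<lambda>_. snd d y"]) (use d in \<open>auto simp: charts_at_iff smooth_on_const\<close>)
qed

lemma smooth_map_id: "smooth_atlas M \<Longrightarrow> smooth_map M M (\<lambda>x. x)"
  by (auto simp: smooth_atlas_def smooth_map_def transition_def o_def vimage_def Int_def)

section \<open>The real line\<close>

abbreviation real_chart :: "(real, real) chart" where
  "real_chart \<equiv> (UNIV, \<lambda>s. s)"

lemma real_line_simps [simp]: "points real_line = UNIV" "charts real_line = {real_chart}"
  by (simp_all add: real_line_def)

lemma charts_at_real_line [simp]: "charts_at real_line t = {real_chart}"
  by (auto simp: charts_at_iff)

lemma chart_inv_real_chart [simp]: "chart_inv real_chart s = s"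
  using inv_into_f_f[of "\<lambda>s. s" UNIV s] by (simp add: chart_inv_def)

lemma smooth_atlas_real_line: "smooth_atlas real_line"
  by (simp add: smooth_atlas_def transition_def o_def smooth_on_id)

lemma smooth_map_real_binop:
  fixes M :: "('m, 'e::finite_dim_inner) manifold"
  assumes M: "smooth_atlas M" and f: "smooth_map M real_line f" and g: "smooth_map M real_line g"
    and op: "bounded_linear (\<lambda>z. op (fst z) (snd z))"
  shows "smooth_map M real_line (\<lambda>x. op (f x) (g x))"
proof (rule smooth_mapI[OF M smooth_atlas_real_line])
  fix x assume x: "x \<in> points M"
  obtain c where c: "c \<in> charts_at M x" using exists_chart_at[OF M x] .
  obtain U L where U: "open U" "snd c x \<in> U" "smooth_on U L"
    and UL: "\<And>y. y \<in> fst c \<Longrightarrow> snd c y \<in> U \<Longrightarrow> f y = L (snd c y)"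
    using smooth_mapE[OF M f c, of real_chart] by auto
  obtain U' L' where U': "open U'" "snd c x \<in> U'" "smooth_on U' L'"
    and UL': "\<And>y. y \<in> fst c \<Longrightarrow> snd c y \<in> U' \<Longrightarrow> g y = L' (snd c y)"
    using smooth_mapE[OF M g c, of real_chart] by auto
  have V: "open (U \<inter> U')" using U U' by auto
  have "smooth_on (U \<inter> U') (\<lambda>y. op (L y) (L' y))"
    using smooth_on_bounded_linear[OF op V smooth_on_Pair[OF V smooth_on_subset[OF U(3)] smooth_on_subset[OF U'(3)]]]
    by simp
  then show "smooth_at M real_line (\<lambda>x. op (f x) (g x)) x"
    using U U' UL UL' by (intro smooth_atI[OF c _ V, of real_chart]) auto
qed

lemma smooth_map_add:
  fixes M :: "('m, 'e::finite_dim_inner) manifold"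
  assumes "smooth_atlas M" "smooth_map M real_line f" "smooth_map M real_line g"
  shows "smooth_map M real_line (\<lambda>x. f x + g x)"
  using smooth_map_real_binop[OF assms, of "(+)"]
  by (simp add: bounded_linear_add bounded_linear_fst bounded_linear_snd)

lemma smooth_map_diff:
  fixes M :: "('m, 'e::finite_dim_inner) manifold"
  assumes "smooth_atlas M" "smooth_map M real_line f" "smooth_map M real_line g"
  shows "smooth_map M real_line (\<lambda>x. f x - g x)"
  using smooth_map_real_binop[OF assms, of "(-)"]
  by (simp add: bounded_linear_sub bounded_linear_fst bounded_linear_snd)

section \<open>Products\<close>

definition product_chart :: "('m, 'e) chart \<Rightarrow> ('k, 'f) chart \<Rightarrow> ('m \<times> 'k, 'e \<times> 'f) chart" where
  "product_chart c d = (fst c \<times> fst d, map_prod (snd c) (snd d))"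

lemma product_chart_simps [simp]:
  "fst (product_chart c d) = fst c \<times> fst d"
  "snd (product_chart c d) z = (snd c (fst z), snd d (snd z))"
  by (simp_all add: product_chart_def map_prod_def split_beta)

lemma product_manifold_simps [simp]:
  "points (product_manifold M N) = points M \<times> points N"
  "charts (product_manifold M N) = {product_chart c d | c d. c \<in> charts M \<and> d \<in> charts N}"
  by (simp_all add: product_manifold_def product_chart_def)

lemma charts_at_product:
  "charts_at (product_manifold M N) z =
    {product_chart c d | c d. c \<in> charts_at M (fst z) \<and> d \<in> charts_at N (snd z)}"
proof (intro equalityI subsetI)
  fix e assume e: "e \<in> charts_at (product_manifold M N) z"
  then obtain c d where "e = product_chart c d" "c \<in> charts M" "d \<in> charts N"
    unfolding charts_at_iff product_manifold_simps by blast
  with e show "e \<in> {product_chart c d | c d. c \<in> charts_at M (fst z) \<and> d \<in> charts_at N (snd z)}"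
    unfolding charts_at_iff mem_Collect_eq by (intro exI[of _ c] exI[of _ d]) (simp add: mem_Times_iff)
next
  fix e assume "e \<in> {product_chart c d | c d. c \<in> charts_at M (fst z) \<and> d \<in> charts_at N (snd z)}"
  then obtain c d where "e = product_chart c d" "c \<in> charts_at M (fst z)" "d \<in> charts_at N (snd z)"
    by blast
  then show "e \<in> charts_at (product_manifold M N) z"
    unfolding charts_at_iff product_manifold_simps by (simp add: mem_Times_iff) blast
qed

lemma product_chart_at:
  "c \<in> charts_at M x \<Longrightarrow> d \<in> charts_at N y \<Longrightarrow> product_chart c d \<in> charts_at (product_manifold M N) (x, y)"
  unfolding charts_at_product by simp blast

lemma image_product_chart: "snd (product_chart c d) ` (A \<times> B) = (snd c ` A) \<times> (snd d ` B)"
  by (force simp: image_iff)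

lemma smooth_atlas_product:
  fixes M :: "('m, 'e::finite_dim_inner) manifold" and N :: "('k, 'f::finite_dim_inner) manifold"
  assumes M: "smooth_atlas M" and N: "smooth_atlas N"
  shows "smooth_atlas (product_manifold M N)"
proof -
  have cov: "(\<Union>c\<in>charts (product_manifold M N). fst c) = points (product_manifold M N)"
  proof (intro equalityI subsetI)
    fix z assume "z \<in> points (product_manifold M N)"
    then have "fst z \<in> points M" "snd z \<in> points N" by auto
    then obtain c d where "c \<in> charts_at M (fst z)" "d \<in> charts_at N (snd z)"
      by (metis exists_chart_at M N)
    then have "product_chart c d \<in> charts_at (product_manifold M N) z"
      using product_chart_at by (metis prod.collapse)
    then show "z \<in> (\<Union>c\<in>charts (product_manifold M N). fst c)"
      unfolding charts_at_iff by blast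
  next
    fix z assume "z \<in> (\<Union>c\<in>charts (product_manifold M N). fst c)"
    then obtain e where "e \<in> charts (product_manifold M N)" "z \<in> fst e" by blast
    then obtain c d where "c \<in> charts M" "d \<in> charts N" "z \<in> fst (product_chart c d)"
      unfolding product_manifold_simps by blast
    then show "z \<in> points (product_manifold M N)"
      using chart_subset_points[OF M] chart_subset_points[OF N] by (simp add: mem_Times_iff)
  qed
  have inj: "inj_on (snd (product_chart c d)) (fst (product_chart c d)) \<and>
      open (snd (product_chart c d) ` fst (product_chart c d))"
    if "c \<in> charts M" "d \<in> charts N" for c d
  proof
    show "inj_on (snd (product_chart c d)) (fst (product_chart c d))"
      using chart_eqD[OF M that(1)] chart_eqD[OF N that(2)] by (auto intro!: inj_onI)
    show "open (snd (product_chart c d) ` fst (product_chart c d))"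
      using open_Times[OF open_chart_image[OF M that(1)] open_chart_image[OF N that(2)]]
      by (simp only: product_chart_simps(1) image_product_chart)
  qed
  have tr: "open S \<and> smooth_on S (transition (product_chart c d) (product_chart c' d'))"
    if c: "c \<in> charts M" "d \<in> charts N" "c' \<in> charts M" "d' \<in> charts N"
      and S: "S = snd (product_chart c d) ` (fst (product_chart c d) \<inter> fst (product_chart c' d'))"
    for c d c' d' S
  proof -
    define A where "A = snd c ` (fst c \<inter> fst c')"
    define B where "B = snd d ` (fst d \<inter> fst d')"
    have S': "S = A \<times> B"
      by (simp only: S A_def B_def image_product_chart[symmetric] product_chart_simps(1) Times_Int_Times)
    have A: "open A" "smooth_on A (transition c c')" and B: "open B" "smooth_on B (transition d d')"
      using M N c by (auto simp: smooth_atlas_def A_def B_def)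
    have oS: "open S" using A B S' by (simp add: open_Times)
    have "smooth_on S (\<lambda>y. transition c c' (fst y))"
      by (rule smooth_on_compose[OF oS _ smooth_on_linear[OF bounded_linear_fst oS] A(2)]) (auto simp: S')
    moreover have "smooth_on S (\<lambda>y. transition d d' (snd y))"
      by (rule smooth_on_compose[OF oS _ smooth_on_linear[OF bounded_linear_snd oS] B(2)]) (auto simp: S')
    ultimately have "smooth_on S (\<lambda>y. (transition c c' (fst y), transition d d' (snd y)))"
      by (rule smooth_on_Pair[OF oS])
    moreover have "transition (product_chart c d) (product_chart c' d') y =
        (transition c c' (fst y), transition d d' (snd y))" if y: "y \<in> S" for y
    proof -
      obtain w where w: "w \<in> fst (product_chart c d)" "y = snd (product_chart c d) w"
        using y unfolding S by blast
      have "chart_inv (product_chart c d) y = w"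
        unfolding chart_inv_def w(2) by (rule inv_into_f_f[OF conjunct1[OF inj[OF c(1,2)]] w(1)])
      then show ?thesis
        using w by (simp add: transition_def mem_Times_iff chart_inv_chart[OF M c(1)] chart_inv_chart[OF N c(2)])
    qed
    ultimately have "smooth_on S (transition (product_chart c d) (product_chart c' d'))"
      using smooth_on_cong[OF oS, of "transition (product_chart c d) (product_chart c' d')"] by simp
    with oS show ?thesis by blast
  qed
  show ?thesis
    unfolding smooth_atlas_def
  proof (intro conjI ballI)
    show "(\<Union>c\<in>charts (product_manifold M N). fst c) = points (product_manifold M N)" by (rule cov)
  next
    fix e assume "e \<in> charts (product_manifold M N)"
    then obtain c d where "e = product_chart c d" "c \<in> charts M" "d \<in> charts N"
      unfolding product_manifold_simps by blast
    then show "inj_on (snd e) (fst e)" "open (snd e ` fst e)" using inj by blast+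
  next
    fix e e' assume "e \<in> charts (product_manifold M N)" "e' \<in> charts (product_manifold M N)"
    then obtain c d c' d' where e: "e = product_chart c d" "e' = product_chart c' d'"
      and c: "c \<in> charts M" "d \<in> charts N" "c' \<in> charts M" "d' \<in> charts N"
      unfolding product_manifold_simps by blast
    show "open (snd e ` (fst e \<inter> fst e'))" "smooth_on (snd e ` (fst e \<inter> fst e')) (transition e e')"
      unfolding e using tr[OF c refl] by simp_all
  qed
qed

lemma smooth_map_fst:
  fixes M :: "('m, 'e::finite_dim_inner) manifold" and N :: "('k, 'f::finite_dim_inner) manifold"
  assumes M: "smooth_atlas M" and N: "smooth_atlas N"
  shows "smooth_map (product_manifold M N) M fst"
proof (rule smooth_mapI[OF smooth_atlas_product[OF M N] M])
  fix z assume "z \<in> points (product_manifold M N)"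
  then have "fst z \<in> points M" "snd z \<in> points N" by auto
  then obtain c d where "c \<in> charts_at M (fst z)" "d \<in> charts_at N (snd z)"
    by (metis exists_chart_at M N)
  then show "smooth_at (product_manifold M N) M fst z"
    by (intro smooth_atI[of "product_chart c d" _ _ c M "fst z" UNIV fst])
      (auto simp: charts_at_iff smooth_on_linear bounded_linear_fst mem_Times_iff)
qed

lemma smooth_map_snd:
  fixes M :: "('m, 'e::finite_dim_inner) manifold" and N :: "('k, 'f::finite_dim_inner) manifold"
  assumes M: "smooth_atlas M" and N: "smooth_atlas N"
  shows "smooth_map (product_manifold M N) N snd"
proof (rule smooth_mapI[OF smooth_atlas_product[OF M N] N])
  fix z assume "z \<in> points (product_manifold M N)"
  then have "fst z \<in> points M" "snd z \<in> points N" by auto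
  then obtain c d where "c \<in> charts_at M (fst z)" "d \<in> charts_at N (snd z)"
    by (metis exists_chart_at M N)
  then show "smooth_at (product_manifold M N) N snd z"
    by (intro smooth_atI[of "product_chart c d" _ _ d N "snd z" UNIV snd])
      (auto simp: charts_at_iff smooth_on_linear bounded_linear_snd mem_Times_iff)
qed

lemma smooth_map_Pair:
  fixes M :: "('m, 'e::finite_dim_inner) manifold" and N :: "('k, 'f::finite_dim_inner) manifold"
    and K :: "('l, 'g::finite_dim_inner) manifold"
  assumes M: "smooth_atlas M" and N: "smooth_atlas N" and K: "smooth_atlas K"
    and F: "smooth_map M N F" and G: "smooth_map M K G"
  shows "smooth_map M (product_manifold N K) (\<lambda>x. (F x, G x))"
proof (rule smooth_mapI[OF M smooth_atlas_product[OF N K]])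
  fix x assume x: "x \<in> points M"
  obtain c where c: "c \<in> charts_at M x" using exists_chart_at[OF M x] .
  obtain d where d: "d \<in> charts_at N (F x)" using exists_chart_at[OF N smooth_map_point[OF F x]] .
  obtain e where e: "e \<in> charts_at K (G x)" using exists_chart_at[OF K smooth_map_point[OF G x]] .
  obtain U L where U: "open U" "snd c x \<in> U" "smooth_on U L"
    and UL: "\<And>y. y \<in> fst c \<Longrightarrow> snd c y \<in> U \<Longrightarrow> F y \<in> fst d \<and> snd d (F y) = L (snd c y)"
    using smooth_mapE[OF M F c d] by metis
  obtain U' L' where U': "open U'" "snd c x \<in> U'" "smooth_on U' L'"
    and UL': "\<And>y. y \<in> fst c \<Longrightarrow> snd c y \<in> U' \<Longrightarrow> G y \<in> fst e \<and> snd e (G y) = L' (snd c y)"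
    using smooth_mapE[OF M G c e] by metis
  have V: "open (U \<inter> U')" using U U' by auto
  have "smooth_on (U \<inter> U') (\<lambda>y. (L y, L' y))"
    by (rule smooth_on_Pair[OF V smooth_on_subset[OF U(3)] smooth_on_subset[OF U'(3)]]) auto
  moreover have "product_chart d e \<in> charts_at (product_manifold N K) (F x, G x)"
    by (rule product_chart_at[OF d e])
  ultimately show "smooth_at M (product_manifold N K) (\<lambda>x. (F x, G x)) x"
    using U U' UL UL' by (intro smooth_atI[OF c _ V]) auto
qed

section \<open>Tangent vectors and differentials\<close>

lemma coordinate_has_derivative:
  assumes F: "smooth_map M N F" and c: "c \<in> charts_at M x" and d: "d \<in> charts_at N (F x)"
  shows "((snd d \<circ> F \<circ> chart_inv c) has_derivative
      frechet_derivative (snd d \<circ> F \<circ> chart_inv c) (at (snd c x))) (at (snd c x))"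
  by (rule smooth_on_has_derivative[OF smooth_map_open_smooth(2)[OF F, of c d]])
    (use c d in \<open>auto simp: charts_at_iff\<close>)

lemma coordinate_derivative_eqI:
  assumes M: "smooth_atlas M" and c: "c \<in> charts_at M x"
    and D: "(L has_derivative D) (at (snd c x))"
    and eq: "\<And>y. y \<in> fst c \<Longrightarrow> f y = L (snd c y)"
  shows "frechet_derivative (f \<circ> chart_inv c) (at (snd c x)) = D"
proof -
  have "frechet_derivative (f \<circ> chart_inv c) (at (snd c x)) = frechet_derivative L (at (snd c x))"
    using c eq by (intro frechet_derivative_cong_open[of "snd c ` fst c"] open_chart_image[OF M])
      (auto simp: charts_at_iff chart_inv_chart[OF M])
  then show ?thesis using frechet_derivativeI[OF D] by simp
qed

lemma coordinate_derivative_cong: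
  assumes M: "smooth_atlas M" and c: "c \<in> charts_at M x"
    and eq: "\<And>y. y \<in> points M \<Longrightarrow> f y = g y"
  shows "frechet_derivative (f \<circ> chart_inv c) (at (snd c x)) =
    frechet_derivative (g \<circ> chart_inv c) (at (snd c x))"
  using c eq by (intro frechet_derivative_cong_open[of "snd c ` fst c"] open_chart_image[OF M])
      (auto simp: charts_at_iff chart_inv_chart[OF M] chart_subset_points[OF M])

text \<open>
  The chain rule in coordinates. With \<open>F\<close> or \<open>G\<close> the identity, it gives the behaviour of coordinate
  expressions under change of charts, since transition maps are the coordinate expressions of the
  identity. The rules for tangent vectors, differentials and \<open>d_fun\<close> below rest on it.
\<close>

lemma coordinate_derivative_compose:
  assumes M: "smooth_atlas M" and N: "smooth_atlas N"
    and F: "smooth_map M N F" and G: "smooth_map N K G"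
    and c: "c \<in> charts_at M x" and d: "d \<in> charts_at N (F x)" and e: "e \<in> charts_at K (G (F x))"
  shows "frechet_derivative (snd e \<circ> (\<lambda>x. G (F x)) \<circ> chart_inv c) (at (snd c x)) v =
    frechet_derivative (snd e \<circ> G \<circ> chart_inv d) (at (snd d (F x)))
      (frechet_derivative (snd d \<circ> F \<circ> chart_inv c) (at (snd c x)) v)"
proof -
  let ?f = "snd d \<circ> F \<circ> chart_inv c" and ?g = "snd e \<circ> G \<circ> chart_inv d"
  let ?h = "snd e \<circ> (\<lambda>x. G (F x)) \<circ> chart_inv c"
  have cx: "chart_inv c (snd c x) = x" using c by (simp add: chart_inv_chart[OF M] charts_at_iff)
  have "(?f has_derivative frechet_derivative ?f (at (snd c x))) (at (snd c x))"
    by (rule coordinate_has_derivative[OF F c d])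
  moreover have "(?g has_derivative frechet_derivative ?g (at (snd d (F x)))) (at (?f (snd c x)))"
    using coordinate_has_derivative[OF G d e] cx by simp
  ultimately have D: "((?g \<circ> ?f) has_derivative
      (frechet_derivative ?g (at (snd d (F x))) \<circ> frechet_derivative ?f (at (snd c x)))) (at (snd c x))"
    by (rule diff_chain_at)
  have "frechet_derivative ?h (at (snd c x)) = frechet_derivative (?g \<circ> ?f) (at (snd c x))"
    using c d smooth_map_open_smooth(1)[OF F, of c d]
    by (intro frechet_derivative_cong_open[of "snd c ` (fst c \<inter> F -` fst d)"])
      (auto simp: charts_at_iff chart_inv_chart[OF M] chart_inv_chart[OF N])
  then show ?thesis using frechet_derivativeI[OF D] by simp
qed

lemma transition_eq_coordinate_id: "transition c d = snd d \<circ> (\<lambda>x. x) \<circ> chart_inv c"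
  by (simp add: transition_def o_def)

lemma transition_has_derivative:
  assumes M: "smooth_atlas M" and c: "c \<in> charts_at M x" and d: "d \<in> charts_at M x"
  shows "(transition c d has_derivative frechet_derivative (transition c d) (at (snd c x))) (at (snd c x))"
  using coordinate_has_derivative[OF smooth_map_id[OF M] c d] by (simp add: transition_eq_coordinate_id)

lemma linear_transition_derivative:
  assumes "smooth_atlas M" "c \<in> charts_at M x" "d \<in> charts_at M x"
  shows "linear (frechet_derivative (transition c d) (at (snd c x)))"
  by (rule has_derivative_linear[OF transition_has_derivative[OF assms]])

lemma transition_self_derivative:
  assumes M: "smooth_atlas M" and c: "c \<in> charts_at M x"
  shows "frechet_derivative (transition c c) (at (snd c x)) v = v"
  using coordinate_derivative_eqI[OF M c has_derivative_ident, of "snd c"] by (simp add: transition_def)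

lemma mem_tangent_vector:
  "(d, w) \<in> tangent_vector M x c v \<longleftrightarrow>
    d \<in> charts_at M x \<and> w = frechet_derivative (transition c d) (at (snd c x)) v"
  by (simp add: tangent_vector_def)

lemma tangent_vector_change_chart:
  assumes M: "smooth_atlas M" and c: "c \<in> charts_at M x" and d: "d \<in> charts_at M x"
  shows "tangent_vector M x c v =
    tangent_vector M x d (frechet_derivative (transition c d) (at (snd c x)) v)"
proof -
  have "frechet_derivative (transition c e) (at (snd c x)) v =
      frechet_derivative (transition d e) (at (snd d x))
        (frechet_derivative (transition c d) (at (snd c x)) v)" if e: "e \<in> charts_at M x" for e
    using coordinate_derivative_compose[OF M M smooth_map_id[OF M] smooth_map_id[OF M] c d e, of v]
    by (simp add: transition_eq_coordinate_id)
  then show ?thesis by (auto simp: tangent_vector_def)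
qed

lemma tangent_spaceI: "c \<in> charts_at M x \<Longrightarrow> tangent_vector M x c v \<in> tangent_space M x"
  by (auto simp: tangent_space_def)

lemma tangent_spaceE:
  assumes "smooth_atlas M" "X \<in> tangent_space M x" "c \<in> charts_at M x"
  obtains v where "X = tangent_vector M x c v"
  using assms tangent_vector_change_chart[OF assms(1)] unfolding tangent_space_def by blast

lemma coordinates_tangent_vector:
  assumes "d \<in> charts_at M x"
  shows "coordinates d (tangent_vector M x c v) = frechet_derivative (transition c d) (at (snd c x)) v"
  using assms by (simp add: coordinates_def mem_tangent_vector)

text \<open>
  Two charts at a point and its image suffice to compute the differential. By the chain rule, each
  pair of charts that occurs in the definition of the differential yields a representative of the
  same tangent vector.
\<close>

lemma differential_tangent_vector:
  assumes M: "smooth_atlas M" and N: "smooth_atlas N" and F: "smooth_map M N F"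
    and c: "c \<in> charts_at M x" and d: "d \<in> charts_at N (F x)"
  shows "differential M N F x (tangent_vector M x c v) =
    tangent_vector N (F x) d (frechet_derivative (snd d \<circ> F \<circ> chart_inv c) (at (snd c x)) v)"
proof -
  have D: "frechet_derivative (snd d' \<circ> F \<circ> chart_inv c') (at (snd c' x))
        (frechet_derivative (transition c c') (at (snd c x)) v) =
      frechet_derivative (transition d d') (at (snd d (F x)))
        (frechet_derivative (snd d \<circ> F \<circ> chart_inv c) (at (snd c x)) v)"
    if d': "d' \<in> charts_at N (F x)" and c': "c' \<in> charts_at M x" for c' d'
    using coordinate_derivative_compose[OF M M smooth_map_id[OF M] F c c' d', of v]
      coordinate_derivative_compose[OF M N F smooth_map_id[OF N] c d d', of v]
    by (simp add: transition_eq_coordinate_id)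
  show ?thesis
  proof (intro equalityI subrelI)
    fix d' w' assume "(d', w') \<in> differential M N F x (tangent_vector M x c v)"
    then obtain c' w where "d' \<in> charts_at N (F x)" "(c', w) \<in> tangent_vector M x c v"
      "w' = frechet_derivative (snd d' \<circ> F \<circ> chart_inv c') (at (snd c' x)) w"
      unfolding differential_def by blast
    then show "(d', w') \<in> tangent_vector N (F x) d
        (frechet_derivative (snd d \<circ> F \<circ> chart_inv c) (at (snd c x)) v)"
      by (simp add: mem_tangent_vector D)
  next
    fix d' w' assume "(d', w') \<in> tangent_vector N (F x) d
        (frechet_derivative (snd d \<circ> F \<circ> chart_inv c) (at (snd c x)) v)"
    then show "(d', w') \<in> differential M N F x (tangent_vector M x c v)"
      unfolding differential_def mem_Collect_eq
      by (intro exI[of _ d'] exI[of _ c] exI[of _ "frechet_derivative (transition c c) (at (snd c x)) v"])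
        (simp add: mem_tangent_vector D c)
  qed
qed

lemma differential_in_tangent_space:
  assumes M: "smooth_atlas M" and N: "smooth_atlas N" and F: "smooth_map M N F"
    and X: "X \<in> tangent_space M x"
  shows "differential M N F x X \<in> tangent_space N (F x)"
proof -
  obtain c v where c: "c \<in> charts_at M x" and X: "X = tangent_vector M x c v"
    using X by (auto simp: tangent_space_def)
  obtain d where d: "d \<in> charts_at N (F x)"
    using exists_chart_at[OF N smooth_map_point[OF F charts_at_point[OF M c]]] .
  show ?thesis unfolding X differential_tangent_vector[OF M N F c d] by (rule tangent_spaceI[OF d])
qed

lemma differential_cong:
  assumes M: "smooth_atlas M" and eq: "\<And>y. y \<in> points M \<Longrightarrow> F y = G y"
    and X: "X \<in> tangent_space M x"
  shows "differential M N F x X = differential M N G x X"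
proof -
  have D: "frechet_derivative (snd d \<circ> F \<circ> chart_inv c) (at (snd c x)) =
      frechet_derivative (snd d \<circ> G \<circ> chart_inv c) (at (snd c x))" if "c \<in> charts_at M x" for c d
    using that by (intro coordinate_derivative_cong[OF M]) (simp_all add: eq)
  have X': "c \<in> charts_at M x" if "(c, v) \<in> X" for c v
    using X that by (auto simp: tangent_space_def mem_tangent_vector)
  have "F x = G x"
    using X eq charts_at_point[OF M] by (auto simp: tangent_space_def)
  then have "(z = (d, frechet_derivative (snd d \<circ> F \<circ> chart_inv c) (at (snd c x)) v) \<and>
        d \<in> charts_at N (F x) \<and> (c, v) \<in> X) =
      (z = (d, frechet_derivative (snd d \<circ> G \<circ> chart_inv c) (at (snd c x)) v) \<and>
        d \<in> charts_at N (G x) \<and> (c, v) \<in> X)" for z d c v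
    using D[of c d] X'[of c v] by (cases "(c, v) \<in> X") simp_all
  then show ?thesis unfolding differential_def by (simp only:)
qed

lemma differential_compose:
  assumes M: "smooth_atlas M" and N: "smooth_atlas N" and K: "smooth_atlas K"
    and F: "smooth_map M N F" and G: "smooth_map N K G" and GF: "smooth_map M K (\<lambda>x. G (F x))"
    and X: "X \<in> tangent_space M x"
  shows "differential N K G (F x) (differential M N F x X) = differential M K (\<lambda>x. G (F x)) x X"
proof -
  obtain c v where c: "c \<in> charts_at M x" and X: "X = tangent_vector M x c v"
    using X by (auto simp: tangent_space_def)
  note Fx = smooth_map_point[OF F charts_at_point[OF M c]]
  obtain d where d: "d \<in> charts_at N (F x)" using exists_chart_at[OF N Fx] .
  obtain e where e: "e \<in> charts_at K (G (F x))" using exists_chart_at[OF K smooth_map_point[OF G Fx]] .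
  show ?thesis
    unfolding X differential_tangent_vector[OF M N F c d] differential_tangent_vector[OF N K G d e]
      differential_tangent_vector[OF M K GF c e]
    by (simp add: coordinate_derivative_compose[OF M N F G c d e])
qed

lemma differential_id:
  assumes M: "smooth_atlas M" and X: "X \<in> tangent_space M x"
  shows "differential M M (\<lambda>x. x) x X = X"
proof -
  obtain c v where c: "c \<in> charts_at M x" and X: "X = tangent_vector M x c v"
    using X by (auto simp: tangent_space_def)
  show ?thesis unfolding X differential_tangent_vector[OF M M smooth_map_id[OF M] c c]
    by (simp add: transition_eq_coordinate_id[symmetric] transition_self_derivative[OF M c])
qed

lemma differential_const:
  assumes M: "smooth_atlas M" and N: "smooth_atlas N" and N': "smooth_map M N (\<lambda>_. y)"
    and X: "X \<in> tangent_space M x" and d: "d \<in> charts_at N y"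
  shows "differential M N (\<lambda>_. y) x X = tangent_vector N y d 0"
proof -
  obtain c v where c: "c \<in> charts_at M x" and X: "X = tangent_vector M x c v"
    using X by (auto simp: tangent_space_def)
  have "frechet_derivative (snd d \<circ> (\<lambda>_. y) \<circ> chart_inv c) (at (snd c x)) v = 0"
    by (simp add: o_def)
  then show ?thesis unfolding X using differential_tangent_vector[OF M N N' c d] by simp
qed

text \<open>
  By the chain rule, every representative of the tangent vector contributes the same number, so
  that \<open>the_elem\<close> in the definition of \<open>d_fun\<close> is applied to a singleton.
\<close>

lemma d_fun_tangent_vector:
  assumes M: "smooth_atlas M" and f: "smooth_map M real_line f" and c: "c \<in> charts_at M x"
  shows "d_fun f x (tangent_vector M x c v) = frechet_derivative (f \<circ> chart_inv c) (at (snd c x)) v"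
proof -
  have id: "snd real_chart \<circ> h \<circ> k = h \<circ> k" for h :: "'z \<Rightarrow> real" and k :: "'y \<Rightarrow> 'z" by (simp add: o_def)
  let ?D = "frechet_derivative (f \<circ> chart_inv c) (at (snd c x)) v"
  have "(\<lambda>(c, v). frechet_derivative (f \<circ> chart_inv c) (at (snd c x)) v) z = ?D"
    if "z \<in> tangent_vector M x c v" for z
  proof -
    obtain c' w where z: "z = (c', w)" by (cases z)
    then show ?thesis
      using that coordinate_derivative_compose[OF M M smooth_map_id[OF M] f c, of c' real_chart v]
      unfolding id by (auto simp: mem_tangent_vector transition_eq_coordinate_id)
  qed
  then have "(\<lambda>(c, v). frechet_derivative (f \<circ> chart_inv c) (at (snd c x)) v) ` tangent_vector M x c v
      = (\<lambda>_. ?D) ` tangent_vector M x c v"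
    by (intro image_cong refl)
  moreover have "(c, frechet_derivative (transition c c) (at (snd c x)) v) \<in> tangent_vector M x c v"
    using c by (simp add: mem_tangent_vector)
  ultimately show ?thesis by (simp add: d_fun_def image_constant)
qed

lemma d_fun_cong:
  assumes M: "smooth_atlas M" and f: "smooth_map M real_line f" and g: "smooth_map M real_line g"
    and eq: "\<And>y. y \<in> points M \<Longrightarrow> f y = g y" and X: "X \<in> tangent_space M x"
  shows "d_fun f x X = d_fun g x X"
proof -
  obtain c v where c: "c \<in> charts_at M x" and X: "X = tangent_vector M x c v"
    using X by (auto simp: tangent_space_def)
  show ?thesis
    unfolding X d_fun_tangent_vector[OF M f c] d_fun_tangent_vector[OF M g c]
    using coordinate_derivative_cong[OF M c, of f g] eq by simp
qed

lemma d_fun_differential: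
  assumes M: "smooth_atlas M" and N: "smooth_atlas N"
    and F: "smooth_map M N F" and f: "smooth_map N real_line f"
    and fF: "smooth_map M real_line (\<lambda>x. f (F x))" and X: "X \<in> tangent_space M x"
  shows "d_fun f (F x) (differential M N F x X) = d_fun (\<lambda>x. f (F x)) x X"
proof -
  have id: "snd real_chart \<circ> h = h" for h :: "'z \<Rightarrow> real" by (simp add: o_def)
  obtain c v where c: "c \<in> charts_at M x" and X: "X = tangent_vector M x c v"
    using X by (auto simp: tangent_space_def)
  obtain d where d: "d \<in> charts_at N (F x)"
    using exists_chart_at[OF N smooth_map_point[OF F charts_at_point[OF M c]]] .
  show ?thesis
    unfolding X differential_tangent_vector[OF M N F c d] d_fun_tangent_vector[OF N f d]
      d_fun_tangent_vector[OF M fF c]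
    using coordinate_derivative_compose[OF M N F f c d, of real_chart v] unfolding id by simp
qed

lemma d_fun_add:
  assumes M: "smooth_atlas M" and f: "smooth_map M real_line f" and g: "smooth_map M real_line g"
    and fg: "smooth_map M real_line (\<lambda>x. f x + g x)" and X: "X \<in> tangent_space M x"
  shows "d_fun (\<lambda>x. f x + g x) x X = d_fun f x X + d_fun g x X"
proof -
  have id: "snd real_chart \<circ> h = h" for h :: "'z \<Rightarrow> real" by (simp add: o_def)
  obtain c v where c: "c \<in> charts_at M x" and X: "X = tangent_vector M x c v"
    using X by (auto simp: tangent_space_def)
  have "(((f \<circ> chart_inv c)) has_derivative frechet_derivative (f \<circ> chart_inv c) (at (snd c x))) (at (snd c x))"
    "(((g \<circ> chart_inv c)) has_derivative frechet_derivative (g \<circ> chart_inv c) (at (snd c x))) (at (snd c x))"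
    using coordinate_has_derivative[OF f c, of real_chart] coordinate_has_derivative[OF g c, of real_chart]
    unfolding id by auto
  from frechet_derivativeI[OF has_derivative_add[OF this]]
  have "frechet_derivative ((\<lambda>x. f x + g x) \<circ> chart_inv c) (at (snd c x)) v =
      frechet_derivative (f \<circ> chart_inv c) (at (snd c x)) v +
      frechet_derivative (g \<circ> chart_inv c) (at (snd c x)) v"
    by (simp add: o_def)
  then show ?thesis
    unfolding X d_fun_tangent_vector[OF M f c] d_fun_tangent_vector[OF M g c]
      d_fun_tangent_vector[OF M fg c] .
qed

lemma d_fun_const:
  assumes M: "smooth_atlas M" and X: "X \<in> tangent_space M x"
    and f: "smooth_map M real_line (\<lambda>_. a)"
  shows "d_fun (\<lambda>_. a) x X = 0"
proof -
  obtain c v where c: "c \<in> charts_at M x" and X: "X = tangent_vector M x c v"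
    using X by (auto simp: tangent_space_def)
  show ?thesis unfolding X d_fun_tangent_vector[OF M f c] by (simp add: o_def)
qed

abbreviation unit_tangent :: "real \<Rightarrow> (real, real) tangent" where
  "unit_tangent t \<equiv> tangent_vector real_line t real_chart 1"

lemma unit_tangent_in_tangent_space: "unit_tangent t \<in> tangent_space real_line t"
  by (rule tangent_spaceI) simp

lemma has_derivative_d_fun_unit_tangent:
  assumes "smooth_map real_line real_line g"
  shows "(g has_real_derivative d_fun g t (unit_tangent t)) (at t)"
proof -
  have id: "snd real_chart \<circ> h \<circ> chart_inv real_chart = h" for h :: "real \<Rightarrow> real" by (simp add: o_def fun_eq_iff)
  have id': "h \<circ> chart_inv real_chart = h" for h :: "real \<Rightarrow> real" by (simp add: o_def fun_eq_iff)
  have D: "(g has_derivative frechet_derivative g (at t)) (at t)"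
    using coordinate_has_derivative[OF assms, of real_chart t real_chart] unfolding id by simp
  have "x * frechet_derivative g (at t) 1 = frechet_derivative g (at t) x" for x
    using linear_cmul[OF has_derivative_linear[OF D], of x 1] by simp
  then have "(g has_real_derivative frechet_derivative g (at t) 1) (at t)"
    by (rule has_derivative_imp_has_field_derivative[OF D])
  then show ?thesis
    using d_fun_tangent_vector[OF smooth_atlas_real_line assms, of real_chart t 1] unfolding id' by simp
qed

lemma d_fun_id_unit_tangent: "d_fun (\<lambda>s. s) t (unit_tangent t) = 1"
  using has_derivative_d_fun_unit_tangent[OF smooth_map_id[OF smooth_atlas_real_line]]
    DERIV_unique[OF _ DERIV_ident] by blast

section \<open>The cotangent bundle\<close>

lemma inner_eq_all_imp_eq: "(\<And>v. w \<bullet> v = w' \<bullet> v) \<Longrightarrow> w = w'" for w w' :: "'a::real_inner"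
  by (metis vector_eq_rdot)

lemma linear_functional_inner:
  fixes f :: "'a::finite_dim_inner \<Rightarrow> real"
  assumes "linear f"
  shows "\<exists>w. \<forall>v. w \<bullet> v = f v"
proof -
  obtain B :: "'a set" where B: "finite B" "\<And>x. (\<Sum>b\<in>B. (x \<bullet> b) *\<^sub>R b) = x"
    using orthonormal_expansion by blast
  have "(\<Sum>b\<in>B. f b *\<^sub>R b) \<bullet> v = f v" for v
  proof -
    have "f v = f (\<Sum>b\<in>B. (v \<bullet> b) *\<^sub>R b)" by (simp only: B(2))
    also have "\<dots> = (\<Sum>b\<in>B. (v \<bullet> b) * f b)"
      by (simp add: linear_sum[OF assms] linear_cmul[OF assms])
    also have "\<dots> = (\<Sum>b\<in>B. f b *\<^sub>R b) \<bullet> v"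
      by (simp add: inner_sum_left inner_commute[of v] mult.commute)
    finally show ?thesis by simp
  qed
  then show ?thesis by blast
qed

text \<open>
  Vectors are determined by their inner products, so the description in the definition of the
  momentum has at most one solution; \<open>linear_functional_inner\<close> provides one for covectors.
\<close>

lemma momentum_eqI:
  "(\<And>v. w \<bullet> v = p (tangent_vector M q c v)) \<Longrightarrow> momentum M c (q, p) = w"
  unfolding momentum_def prod.case
  by (rule the_equality, simp, rule inner_eq_all_imp_eq, simp)

lemma inner_momentum:
  fixes M :: "('m, 'e::finite_dim_inner) manifold"
  assumes "p \<in> cotangent_space M q" "c \<in> charts_at M q"
  shows "momentum M c (q, p) \<bullet> v = p (tangent_vector M q c v)"
proof -
  have "linear (\<lambda>v. p (tangent_vector M q c v))" using assms by (simp add: cotangent_space_def)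
  then obtain w where "\<forall>v. w \<bullet> v = p (tangent_vector M q c v)"
    using linear_functional_inner by blast
  then show ?thesis using momentum_eqI[of w p M q c] by simp
qed

lemma cotangent_eqI:
  fixes M :: "('m, 'e::finite_dim_inner) manifold"
  assumes M: "smooth_atlas M" and c: "c \<in> charts_at M q"
    and p: "p \<in> cotangent_space M q" "p' \<in> cotangent_space M q"
    and eq: "momentum M c (q, p) = momentum M c (q, p')"
  shows "p = p'"
proof (rule extensionalityI)
  show "p \<in> extensional (tangent_space M q)" "p' \<in> extensional (tangent_space M q)"
    using p by (simp_all add: cotangent_space_def)
  fix X assume "X \<in> tangent_space M q"
  then obtain v where "X = tangent_vector M q c v" using tangent_spaceE[OF M _ c] by blast
  then show "p X = p' X" using inner_momentum[OF p(1) c, of v] inner_momentum[OF p(2) c, of v] eq by simp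
qed

text \<open>
  The inverse of the chart of the cotangent bundle on a fibre, by \<open>momentum_covector\<close>.
\<close>

definition covector :: "('m, 'e::real_inner) manifold \<Rightarrow> ('m, 'e) chart \<Rightarrow> 'm \<Rightarrow> 'e \<Rightarrow> ('m, 'e) cotangent" where
  "covector M c q w = restrict (\<lambda>X. w \<bullet> coordinates c X) (tangent_space M q)"

lemma covector_tangent_vector:
  assumes "c \<in> charts_at M q" "d \<in> charts_at M q"
  shows "covector M c q w (tangent_vector M q d v) =
    w \<bullet> frechet_derivative (transition d c) (at (snd d q)) v"
  using assms by (simp add: covector_def tangent_spaceI coordinates_tangent_vector)

lemma covector_in_cotangent_space:
  assumes M: "smooth_atlas M" and c: "c \<in> charts_at M q"
  shows "covector M c q w \<in> cotangent_space M q"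
proof -
  have "linear (\<lambda>v. covector M c q w (tangent_vector M q d v))" if d: "d \<in> charts_at M q" for d
  proof -
    note lin = linear_transition_derivative[OF M d c]
    show ?thesis unfolding covector_tangent_vector[OF c d]
      by (rule linearI) (simp_all add: linear_add[OF lin] linear_cmul[OF lin] inner_add_right)
  qed
  moreover have "covector M c q w \<in> extensional (tangent_space M q)" by (simp add: covector_def)
  ultimately show ?thesis by (simp add: cotangent_space_def)
qed

lemma momentum_covector:
  assumes "smooth_atlas M" "c \<in> charts_at M q"
  shows "momentum M c (q, covector M c q w) = w"
  using assms by (intro momentum_eqI) (simp add: covector_tangent_vector transition_self_derivative)

lemma cotangent_chart_simps [simp]:
  "fst (cotangent_chart M c) = Sigma (fst c) (cotangent_space M)"
  "snd (cotangent_chart M c) z = (snd c (fst z), momentum M c z)"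
  by (simp_all add: cotangent_chart_def)

lemma cotangent_bundle_simps [simp]:
  "points (cotangent_bundle M) = Sigma (points M) (cotangent_space M)"
  "charts (cotangent_bundle M) = cotangent_chart M ` charts M"
  by (simp_all add: cotangent_bundle_def)

lemma cotangent_chart_at:
  "c \<in> charts_at M q \<Longrightarrow> p \<in> cotangent_space M q \<Longrightarrow>
    cotangent_chart M c \<in> charts_at (cotangent_bundle M) (q, p)"
  by (simp add: charts_at_iff)

lemma image_cotangent_chart:
  fixes M :: "('m, 'e::finite_dim_inner) manifold"
  assumes M: "smooth_atlas M" and c: "c \<in> charts M" and A: "A \<subseteq> fst c"
  shows "snd (cotangent_chart M c) ` Sigma A (cotangent_space M) = (snd c ` A) \<times> UNIV"
proof (intro equalityI subsetI)
  fix y assume "y \<in> snd (cotangent_chart M c) ` Sigma A (cotangent_space M)"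
  then show "y \<in> (snd c ` A) \<times> UNIV" by auto
next
  fix y assume "y \<in> (snd c ` A) \<times> (UNIV :: 'e set)"
  then obtain q where q: "q \<in> A" "fst y = snd c q" by auto
  then have cq: "c \<in> charts_at M q" using c A by (auto simp: charts_at_iff)
  have "y = snd (cotangent_chart M c) (q, covector M c q (snd y))"
    using q by (simp add: momentum_covector[OF M cq] prod_eq_iff)
  then show "y \<in> snd (cotangent_chart M c) ` Sigma A (cotangent_space M)"
    using q covector_in_cotangent_space[OF M cq] by (intro image_eqI) auto
qed

lemma inj_on_cotangent_chart:
  fixes M :: "('m, 'e::finite_dim_inner) manifold"
  assumes M: "smooth_atlas M" and c: "c \<in> charts M"
  shows "inj_on (snd (cotangent_chart M c)) (fst (cotangent_chart M c))"
proof (rule inj_onI)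
  fix z z' assume z: "z \<in> fst (cotangent_chart M c)" "z' \<in> fst (cotangent_chart M c)"
    and eq: "snd (cotangent_chart M c) z = snd (cotangent_chart M c) z'"
  obtain q p where zp: "z = (q, p)" by (cases z)
  obtain q' p' where zp': "z' = (q', p')" by (cases z')
  have "q = q'" using chart_eqD[OF M c, of q q'] z eq by (simp add: zp zp')
  moreover have "p = p'" if "q = q'"
    using z eq c that by (intro cotangent_eqI[OF M, of c q]) (simp_all add: zp zp' charts_at_iff)
  ultimately show "z = z'" by (simp add: zp zp')
qed

text \<open>
  The transposed derivative of the transition from \<open>d\<close> to \<open>c\<close>, written out in an orthonormal basis
  in order to expose smooth dependence on the base point.
\<close>

lemma momentum_change_chart:
  fixes M :: "('m, 'e::finite_dim_inner) manifold"
  assumes M: "smooth_atlas M" and c: "c \<in> charts_at M q" and d: "d \<in> charts_at M q"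
    and p: "p \<in> cotangent_space M q" and B: "\<And>x::'e. (\<Sum>b\<in>B. (x \<bullet> b) *\<^sub>R b) = x"
  shows "momentum M d (q, p) =
    (\<Sum>b\<in>B. (momentum M c (q, p) \<bullet> frechet_derivative (transition d c) (at (snd d q)) b) *\<^sub>R b)"
proof -
  have "momentum M d (q, p) \<bullet> b =
      momentum M c (q, p) \<bullet> frechet_derivative (transition d c) (at (snd d q)) b" for b
    unfolding inner_momentum[OF p c] inner_momentum[OF p d] tangent_vector_change_chart[OF M d c, of b] ..
  then show ?thesis using B[of "momentum M d (q, p)"] by simp
qed

text \<open>
  Over the overlap of two charts \<open>c\<close> and \<open>d\<close>, the transition map is that of the base on the first
  component and, by \<open>momentum_change_chart\<close>, linear in the momentum on the second, where the
  coefficients are derivatives of the inverse transition and thus smooth in the base point.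
\<close>

lemma smooth_atlas_cotangent_bundle:
  fixes M :: "('m, 'e::finite_dim_inner) manifold"
  assumes M: "smooth_atlas M"
  shows "smooth_atlas (cotangent_bundle M)"
proof -
  obtain B :: "'e set" where B: "finite B" "\<And>x. (\<Sum>b\<in>B. (x \<bullet> b) *\<^sub>R b) = x"
    using orthonormal_expansion by blast
  have tr: "open S \<and> smooth_on S (transition (cotangent_chart M c) (cotangent_chart M d))"
    if c: "c \<in> charts M" and d: "d \<in> charts M"
      and S: "S = snd (cotangent_chart M c) ` (fst (cotangent_chart M c) \<inter> fst (cotangent_chart M d))"
    for c d S
  proof -
    define A where "A = snd c ` (fst c \<inter> fst d)"
    define A' where "A' = snd d ` (fst d \<inter> fst c)"
    have A: "open A" "smooth_on A (transition c d)" "smooth_on A' (transition d c)"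
      using M c d by (auto simp: smooth_atlas_def A_def A'_def)
    have tA: "transition c d ` A \<subseteq> A'"
      using transition_chart[OF M c, of _ d] by (auto simp: A_def A'_def)
    have dom: "fst (cotangent_chart M c) \<inter> fst (cotangent_chart M d) =
        Sigma (fst c \<inter> fst d) (cotangent_space M)" by auto
    have S': "S = A \<times> UNIV"
      unfolding S dom A_def by (rule image_cotangent_chart[OF M c]) auto
    have oS: "open S" using A S' by (simp add: open_Times)
    define f where "f y = transition c d (fst y)" for y :: "'e \<times> 'e"
    have f: "smooth_on S f" unfolding f_def
      by (rule smooth_on_compose[OF oS _ smooth_on_linear[OF bounded_linear_fst oS] A(2)]) (auto simp: S')
    have D: "smooth_on S (\<lambda>y. frechet_derivative (transition d c) (at (f y)) b)" for b
      by (rule smooth_on_compose[OF oS _ f smooth_on_frechet_derivative[OF A(3)]])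
        (use tA in \<open>auto simp: S' f_def\<close>)
    have "smooth_on S (\<lambda>y. (snd y \<bullet> frechet_derivative (transition d c) (at (f y)) b) *\<^sub>R b)" for b
      by (rule smooth_on_bounded_linear[OF bounded_linear_scaleR_left oS
            smooth_on_bounded_bilinear[OF bounded_bilinear_inner oS smooth_on_linear[OF bounded_linear_snd oS] D]])
    then have "smooth_on S (\<lambda>y. \<Sum>b\<in>B. (snd y \<bullet> frechet_derivative (transition d c) (at (f y)) b) *\<^sub>R b)"
      by (intro smooth_on_sum oS)
    then have "smooth_on S (\<lambda>y. (f y, \<Sum>b\<in>B. (snd y \<bullet> frechet_derivative (transition d c) (at (f y)) b) *\<^sub>R b))"
      by (rule smooth_on_Pair[OF oS f])
    moreover have "transition (cotangent_chart M c) (cotangent_chart M d) y =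
        (f y, \<Sum>b\<in>B. (snd y \<bullet> frechet_derivative (transition d c) (at (f y)) b) *\<^sub>R b)"
      if y: "y \<in> S" for y
    proof -
      obtain z where z: "z \<in> Sigma (fst c \<inter> fst d) (cotangent_space M)" "y = snd (cotangent_chart M c) z"
        using y unfolding S dom by blast
      obtain q p where qp: "z = (q, p)" by (cases z)
      have q: "c \<in> charts_at M q" "d \<in> charts_at M q" "p \<in> cotangent_space M q"
        using z c d by (auto simp: qp charts_at_iff)
      have fy: "f y = snd d q"
        using q z(2) by (simp add: f_def qp transition_chart[OF M c] charts_at_iff)
      have sy: "snd y = momentum M c (q, p)" using z(2) by (simp add: qp)
      have "chart_inv (cotangent_chart M c) y = z"
        unfolding chart_inv_def z(2)
        by (rule inv_into_f_f[OF inj_on_cotangent_chart[OF M c]]) (use z(1) in auto)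
      then have "transition (cotangent_chart M c) (cotangent_chart M d) y = (snd d q, momentum M d z)"
        by (simp add: transition_def qp)
      then show ?thesis
        unfolding fy sy using momentum_change_chart[OF M q B(2)] by (simp add: qp)
    qed
    ultimately have "smooth_on S (transition (cotangent_chart M c) (cotangent_chart M d))"
      using smooth_on_cong[OF oS, of "transition (cotangent_chart M c) (cotangent_chart M d)"] by simp
    with oS show ?thesis by blast
  qed
  show ?thesis
    unfolding smooth_atlas_def
  proof (intro conjI ballI)
    show "(\<Union>c\<in>charts (cotangent_bundle M). fst c) = points (cotangent_bundle M)"
    proof (intro equalityI subsetI)
      fix z assume "z \<in> points (cotangent_bundle M)"
      then have z: "fst z \<in> points M" "snd z \<in> cotangent_space M (fst z)" by auto
      obtain c where "c \<in> charts_at M (fst z)" using exists_chart_at[OF M z(1)] .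
      then have "cotangent_chart M c \<in> charts_at (cotangent_bundle M) z"
        using cotangent_chart_at[of c M "fst z" "snd z"] z by simp
      then show "z \<in> (\<Union>c\<in>charts (cotangent_bundle M). fst c)" unfolding charts_at_iff by blast
    next
      fix z assume "z \<in> (\<Union>c\<in>charts (cotangent_bundle M). fst c)"
      then obtain c where "c \<in> charts M" "z \<in> fst (cotangent_chart M c)"
        unfolding cotangent_bundle_simps by blast
      then show "z \<in> points (cotangent_bundle M)" using chart_subset_points[OF M, of c] by auto
    qed
  next
    fix e assume "e \<in> charts (cotangent_bundle M)"
    then obtain c where e: "e = cotangent_chart M c" and c: "c \<in> charts M"
      unfolding cotangent_bundle_simps by blast
    show "inj_on (snd e) (fst e)" unfolding e by (rule inj_on_cotangent_chart[OF M c])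
    show "open (snd e ` fst e)"
      unfolding e cotangent_chart_simps(1) image_cotangent_chart[OF M c order_refl]
      by (intro open_Times open_chart_image[OF M c] open_UNIV)
  next
    fix e e' assume "e \<in> charts (cotangent_bundle M)" "e' \<in> charts (cotangent_bundle M)"
    then obtain c d where e: "e = cotangent_chart M c" "e' = cotangent_chart M d"
      and c: "c \<in> charts M" "d \<in> charts M"
      unfolding cotangent_bundle_simps by blast
    show "open (snd e ` (fst e \<inter> fst e'))" "smooth_on (snd e ` (fst e \<inter> fst e')) (transition e e')"
      unfolding e using tr[OF c refl] by simp_all
  qed
qed

section \<open>Phase space with time, and the extended phase space\<close>

lemma differential_in_charts:
  fixes M :: "('m, 'e::finite_dim_inner) manifold" and N :: "('k, 'f::finite_dim_inner) manifold"
  assumes M: "smooth_atlas M" and N: "smooth_atlas N" and F: "smooth_map M N F"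
    and c: "c \<in> charts_at M x" and d: "d \<in> charts_at N (F x)"
    and D: "(L has_derivative D) (at (snd c x))"
    and L: "\<And>y. y \<in> fst c \<Longrightarrow> snd d (F y) = L (snd c y)"
  shows "differential M N F x (tangent_vector M x c v) = tangent_vector N (F x) d (D v)"
proof -
  have "frechet_derivative (snd d \<circ> F \<circ> chart_inv c) (at (snd c x)) = D"
    by (rule coordinate_derivative_eqI[OF M c D]) (simp add: L)
  then show ?thesis using differential_tangent_vector[OF M N F c d, of v] by simp
qed

lemma smooth_map_linear_in_charts:
  fixes M :: "('m, 'e::finite_dim_inner) manifold" and N :: "('k, 'f::finite_dim_inner) manifold"
  assumes M: "smooth_atlas M" and N: "smooth_atlas N" and L: "bounded_linear L"
    and F: "\<And>x. x \<in> points M \<Longrightarrow> \<exists>c\<in>charts_at M x. \<exists>d\<in>charts_at N (F x).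
      \<forall>y\<in>fst c. F y \<in> fst d \<and> snd d (F y) = L (snd c y)"
  shows "smooth_map M N F"
proof (rule smooth_mapI[OF M N])
  fix x assume "x \<in> points M"
  then obtain c d where c: "c \<in> charts_at M x" and d: "d \<in> charts_at N (F x)"
    and cd: "\<forall>y\<in>fst c. F y \<in> fst d \<and> snd d (F y) = L (snd c y)"
    using F by blast
  show "smooth_at M N F x"
    by (rule smooth_atI[OF c d open_UNIV]) (use cd smooth_on_linear[OF L open_UNIV] in auto)
qed

context
  fixes Q :: "('q, 'e::finite_dim_inner) manifold"
  assumes Q: "smooth_atlas Q"
begin

abbreviation "time_chart c \<equiv> product_chart c real_chart"

lemma atlas_config_time: "smooth_atlas (config_time Q)"
  unfolding config_time_def by (rule smooth_atlas_product[OF Q smooth_atlas_real_line])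

lemma atlas_phase_time: "smooth_atlas (phase_time Q)"
  unfolding phase_time_def
  by (rule smooth_atlas_product[OF smooth_atlas_cotangent_bundle[OF Q] smooth_atlas_real_line])

lemma atlas_ext_phase_space: "smooth_atlas (ext_phase_space Q)"
  unfolding ext_phase_space_def by (rule smooth_atlas_cotangent_bundle[OF atlas_config_time])

lemma time_chart_at_config_time:
  "c \<in> charts_at Q q \<Longrightarrow> time_chart c \<in> charts_at (config_time Q) (q, t)"
  unfolding config_time_def by (rule product_chart_at) simp_all

lemma charts_at_config_timeE:
  assumes "d \<in> charts_at (config_time Q) (q, t)"
  obtains c where "c \<in> charts_at Q q" "d = time_chart c"
  using assms unfolding config_time_def charts_at_product by auto

text \<open>
  In the chart \<open>time_chart c\<close>, the slices \<open>Q \<times> {t}\<close> and \<open>{q} \<times> \<real>\<close> are the coordinate directions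
  \<open>(v, 0)\<close> and \<open>(0, s)\<close>. Hence \<open>proj_mu\<close> and \<open>coord_u\<close> read off the two components of the momentum
  in the lemmas below.
\<close>

lemma differential_space_slice:
  assumes c: "c \<in> charts_at Q q"
  shows "differential Q (config_time Q) (\<lambda>q'. (q', t)) q (tangent_vector Q q c v) =
    tangent_vector (config_time Q) (q, t) (time_chart c) (v, 0)"
proof (rule differential_in_charts[OF Q atlas_config_time _ c])
  show "smooth_map Q (config_time Q) (\<lambda>q'. (q', t))"
    unfolding config_time_def
    by (intro smooth_map_Pair[OF Q Q smooth_atlas_real_line] smooth_map_id Q
        smooth_map_const smooth_atlas_real_line) simp
  show "time_chart c \<in> charts_at (config_time Q) (q, t)" using c by (simp add: time_chart_at_config_time)
  show "((\<lambda>x. (x, t)) has_derivative (\<lambda>v. (v, 0))) (at (snd c q))"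
    by (auto intro!: derivative_eq_intros)
qed simp

lemma differential_time_slice:
  assumes c: "c \<in> charts_at Q q"
  shows "differential real_line (config_time Q) (\<lambda>s. (q, s)) t (unit_tangent t) =
    tangent_vector (config_time Q) (q, t) (time_chart c) (0, 1)"
proof (rule differential_in_charts[OF smooth_atlas_real_line atlas_config_time])
  show "smooth_map real_line (config_time Q) (\<lambda>s. (q, s))"
    unfolding config_time_def
    by (intro smooth_map_Pair[OF smooth_atlas_real_line Q smooth_atlas_real_line] smooth_map_id
        smooth_map_const smooth_atlas_real_line Q charts_at_point[OF Q c])
  show "time_chart c \<in> charts_at (config_time Q) (q, t)" using c by (simp add: time_chart_at_config_time)
  show "((\<lambda>s. (snd c q, s)) has_derivative (\<lambda>s. (0, s))) (at (snd real_chart t))"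
    by (auto intro!: derivative_eq_intros)
qed simp_all

lemma differential_config_space:
  assumes c: "c \<in> charts_at Q q"
  shows "differential (config_time Q) Q fst (q, t) (tangent_vector (config_time Q) (q, t) (time_chart c) w) =
    tangent_vector Q q c (fst w)"
proof -
  have "differential (config_time Q) Q fst (q, t) (tangent_vector (config_time Q) (q, t) (time_chart c) w) =
      tangent_vector Q (fst (q, t)) c (fst w)"
  proof (rule differential_in_charts[OF atlas_config_time Q])
    show "smooth_map (config_time Q) Q fst"
      unfolding config_time_def by (rule smooth_map_fst[OF Q smooth_atlas_real_line])
    show "time_chart c \<in> charts_at (config_time Q) (q, t)" "c \<in> charts_at Q (fst (q, t))"
      using c by (simp_all add: time_chart_at_config_time)
    show "(fst has_derivative fst) (at (snd (time_chart c) (q, t)))"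
      by (rule bounded_linear_imp_has_derivative[OF bounded_linear_fst])
  qed simp
  then show ?thesis by simp
qed

lemma d_fun_config_time:
  assumes c: "c \<in> charts_at Q q"
  shows "d_fun snd (q, t) (tangent_vector (config_time Q) (q, t) (time_chart c) w) = snd w"
proof -
  have s: "smooth_map (config_time Q) real_line snd"
    unfolding config_time_def by (rule smooth_map_snd[OF Q smooth_atlas_real_line])
  have tc: "time_chart c \<in> charts_at (config_time Q) (q, t)" using c by (simp add: time_chart_at_config_time)
  show ?thesis
    unfolding d_fun_tangent_vector[OF atlas_config_time s tc]
    using coordinate_derivative_eqI[OF atlas_config_time tc
        bounded_linear_imp_has_derivative[OF bounded_linear_snd], of snd] by simp
qed

lemma points_phase_time: "((q, p), t) \<in> points (phase_time Q) \<longleftrightarrow> q \<in> points Q \<and> p \<in> cotangent_space Q q"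
  by (simp add: phase_time_def)

lemma points_ext_phase_space:
  "((q, t), p) \<in> points (ext_phase_space Q) \<longleftrightarrow> q \<in> points Q \<and> p \<in> cotangent_space (config_time Q) (q, t)"
  by (simp add: ext_phase_space_def config_time_def)

abbreviation "phase_time_chart c \<equiv> product_chart (cotangent_chart Q c) real_chart"
abbreviation "ext_chart c \<equiv> cotangent_chart (config_time Q) (time_chart c)"

lemma phase_time_chart_at:
  assumes "c \<in> charts_at Q q" "p \<in> cotangent_space Q q"
  shows "phase_time_chart c \<in> charts_at (phase_time Q) ((q, p), t)"
  unfolding phase_time_def using assms by (intro product_chart_at cotangent_chart_at) simp_all

lemma ext_chart_at:
  assumes "c \<in> charts_at Q q" "p \<in> cotangent_space (config_time Q) (q, t)"
  shows "ext_chart c \<in> charts_at (ext_phase_space Q) ((q, t), p)"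
  unfolding ext_phase_space_def using assms by (intro cotangent_chart_at) (simp_all add: time_chart_at_config_time)

lemma proj_mu_value:
  assumes c: "c \<in> charts_at Q q"
  shows "snd (fst (proj_mu Q ((q, t), p))) (tangent_vector Q q c v) =
    p (tangent_vector (config_time Q) (q, t) (time_chart c) (v, 0))"
  using c by (simp add: proj_mu_def tangent_spaceI differential_space_slice)

lemma proj_mu_fst_snd [simp]:
  "fst (fst (proj_mu Q ((q, t), p))) = q" "snd (proj_mu Q ((q, t), p)) = t"
  by (simp_all add: proj_mu_def)

lemma proj_mu_cotangent:
  assumes p: "p \<in> cotangent_space (config_time Q) (q, t)"
  shows "snd (fst (proj_mu Q ((q, t), p))) \<in> cotangent_space Q q"
proof -
  have "linear (\<lambda>v. snd (fst (proj_mu Q ((q, t), p))) (tangent_vector Q q c v))" if c: "c \<in> charts_at Q q" for c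
  proof -
    have lin: "linear (\<lambda>w. p (tangent_vector (config_time Q) (q, t) (time_chart c) w))"
      using p c by (simp add: cotangent_space_def time_chart_at_config_time)
    have "linear (\<lambda>v::'e. (v, 0::real))" by (rule linearI) simp_all
    from linear_compose[OF this lin] show ?thesis unfolding proj_mu_value[OF c] by (simp add: o_def)
  qed
  moreover have "snd (fst (proj_mu Q ((q, t), p))) \<in> extensional (tangent_space Q q)"
    by (simp add: proj_mu_def)
  ultimately show ?thesis by (simp add: cotangent_space_def)
qed

lemma momentum_proj_mu:
  assumes c: "c \<in> charts_at Q q" and p: "p \<in> cotangent_space (config_time Q) (q, t)"
  shows "momentum Q c (fst (proj_mu Q ((q, t), p))) = fst (momentum (config_time Q) (time_chart c) ((q, t), p))"
proof -
  have tc: "time_chart c \<in> charts_at (config_time Q) (q, t)" using c by (simp add: time_chart_at_config_time)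
  have "momentum Q c (q, snd (fst (proj_mu Q ((q, t), p)))) = fst (momentum (config_time Q) (time_chart c) ((q, t), p))"
  proof (rule momentum_eqI)
    fix v
    show "fst (momentum (config_time Q) (time_chart c) ((q, t), p)) \<bullet> v =
        snd (fst (proj_mu Q ((q, t), p))) (tangent_vector Q q c v)"
      using inner_momentum[OF p tc, of "(v, 0)"] by (simp add: proj_mu_value[OF c] inner_prod_def)
  qed
  moreover have "(q, snd (fst (proj_mu Q ((q, t), p)))) = fst (proj_mu Q ((q, t), p))"
    by (simp add: prod_eq_iff)
  ultimately show ?thesis by simp
qed

lemma coord_u_momentum:
  assumes c: "c \<in> charts_at Q q" and p: "p \<in> cotangent_space (config_time Q) (q, t)"
  shows "coord_u Q ((q, t), p) = snd (momentum (config_time Q) (time_chart c) ((q, t), p))"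
proof -
  have tc: "time_chart c \<in> charts_at (config_time Q) (q, t)" using c by (simp add: time_chart_at_config_time)
  show ?thesis using inner_momentum[OF p tc, of "(0, 1)"]
    by (simp add: coord_u_def differential_time_slice[OF c] inner_prod_def)
qed

text \<open>
  The covector on \<open>Q \<times> \<real>\<close> with restriction \<open>p\<close> to \<open>Q\<close> and value \<open>u\<close> on \<open>\<partial>/\<partial>t\<close>, i.e. \<open>p \<circ> d\<pi> + u dt\<close> with
  \<open>\<pi>\<close> the projection to \<open>Q\<close>. It inverts the pair \<open>(proj_mu, coord_u)\<close>.
\<close>

definition ext_point :: "('q, 'e) phase_time_point \<Rightarrow> real \<Rightarrow> ('q, 'e) ext_phase_point" where
  "ext_point = (\<lambda>((q, p), t) u. ((q, t),
     restrict (\<lambda>X. p (differential (config_time Q) Q fst (q, t) X) + u * d_fun snd (q, t) X)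
       (tangent_space (config_time Q) (q, t))))"

lemma ext_point_value:
  assumes c: "c \<in> charts_at Q q"
  shows "snd (ext_point ((q, p), t) u) (tangent_vector (config_time Q) (q, t) (time_chart c) w) =
    p (tangent_vector Q q c (fst w)) + u * snd w"
  using c by (simp add: ext_point_def tangent_spaceI time_chart_at_config_time differential_config_space d_fun_config_time)

lemma fst_ext_point [simp]: "fst (ext_point ((q, p), t) u) = (q, t)"
  by (simp add: ext_point_def)

lemma ext_point_cotangent:
  assumes p: "p \<in> cotangent_space Q q"
  shows "snd (ext_point ((q, p), t) u) \<in> cotangent_space (config_time Q) (q, t)"
proof -
  have "linear (\<lambda>v. snd (ext_point ((q, p), t) u) (tangent_vector (config_time Q) (q, t) d v))"
    if d': "d \<in> charts_at (config_time Q) (q, t)" for d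
  proof -
    obtain c where c: "c \<in> charts_at Q q" and d: "d = time_chart c" by (rule charts_at_config_timeE[OF d'])
    have lin: "linear (\<lambda>v. p (tangent_vector Q q c v))" using p c by (simp add: cotangent_space_def)
    show ?thesis unfolding d ext_point_value[OF c]
      by (rule linearI) (simp_all add: linear_add[OF lin] linear_cmul[OF lin] algebra_simps)
  qed
  moreover have "snd (ext_point ((q, p), t) u) \<in> extensional (tangent_space (config_time Q) (q, t))"
    by (simp add: ext_point_def)
  ultimately show ?thesis by (simp add: cotangent_space_def)
qed

lemma momentum_ext_point:
  assumes c: "c \<in> charts_at Q q" and p: "p \<in> cotangent_space Q q"
  shows "momentum (config_time Q) (time_chart c) (ext_point ((q, p), t) u) = (momentum Q c (q, p), u)"
proof -
  have "momentum (config_time Q) (time_chart c) ((q, t), snd (ext_point ((q, p), t) u)) = (momentum Q c (q, p), u)"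
    by (rule momentum_eqI) (simp add: ext_point_value[OF c] inner_momentum[OF p c] inner_prod_def)
  moreover have "((q, t), snd (ext_point ((q, p), t) u)) = ext_point ((q, p), t) u" by (simp add: prod_eq_iff)
  ultimately show ?thesis by simp
qed

text \<open>
  In canonical coordinates the projection and \<open>u\<close> are linear maps that only rearrange components.
  Together with the same statement for \<open>ext_point\<close>, this yields both their smoothness and the fact
  that they are inverse to each other, by injectivity of charts.
\<close>

lemma proj_mu_chart:
  assumes c: "c \<in> charts Q" and z: "z \<in> fst (ext_chart c)"
  shows "proj_mu Q z \<in> fst (phase_time_chart c)"
    and "snd (phase_time_chart c) (proj_mu Q z) =
      (case snd (ext_chart c) z of ((x, t), (\<xi>, u)) \<Rightarrow> ((x, \<xi>), t))"
    and "coord_u Q z = snd (snd (snd (ext_chart c) z))"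
proof -
  obtain q t p where zp: "z = ((q, t), p)" by (metis surj_pair)
  have c': "c \<in> charts_at Q q" and p: "p \<in> cotangent_space (config_time Q) (q, t)"
    using c z by (simp_all add: zp charts_at_iff)
  have eq: "proj_mu Q z = ((q, snd (fst (proj_mu Q z))), t)" by (simp add: zp prod_eq_iff)
  show "proj_mu Q z \<in> fst (phase_time_chart c)"
    using proj_mu_cotangent[OF p] c' by (subst eq) (simp add: zp charts_at_iff)
  show "snd (phase_time_chart c) (proj_mu Q z) =
      (case snd (ext_chart c) z of ((x, t), (\<xi>, u)) \<Rightarrow> ((x, \<xi>), t))"
    using momentum_proj_mu[OF c' p] by (simp add: zp split_beta)
  show "coord_u Q z = snd (snd (snd (ext_chart c) z))"
    using coord_u_momentum[OF c' p] by (simp add: zp)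
qed

lemma ext_point_chart:
  assumes c: "c \<in> charts Q" and m: "m \<in> fst (phase_time_chart c)"
  shows "ext_point m u \<in> fst (ext_chart c)"
    and "snd (ext_chart c) (ext_point m u) =
      (case snd (phase_time_chart c) m of ((x, \<xi>), t) \<Rightarrow> ((x, t), (\<xi>, u)))"
proof -
  obtain q p t where mp: "m = ((q, p), t)" by (metis surj_pair)
  have c': "c \<in> charts_at Q q" and p: "p \<in> cotangent_space Q q"
    using c m by (simp_all add: mp charts_at_iff)
  have eq: "ext_point m u = ((q, t), snd (ext_point m u))" by (simp add: mp prod_eq_iff)
  show "ext_point m u \<in> fst (ext_chart c)"
    using ext_point_cotangent[OF p] c' by (subst eq) (simp add: mp charts_at_iff)
  show "snd (ext_chart c) (ext_point m u) =
      (case snd (phase_time_chart c) m of ((x, \<xi>), t) \<Rightarrow> ((x, t), (\<xi>, u)))"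
    using momentum_ext_point[OF c' p] by (simp add: mp)
qed

lemma exists_ext_chart:
  assumes "z \<in> points (ext_phase_space Q)"
  obtains c where "c \<in> charts Q" "z \<in> fst (ext_chart c)" "ext_chart c \<in> charts_at (ext_phase_space Q) z"
proof -
  obtain q t p where zp: "z = ((q, t), p)" by (metis surj_pair)
  have q: "q \<in> points Q" "p \<in> cotangent_space (config_time Q) (q, t)"
    using assms by (simp_all add: zp points_ext_phase_space)
  obtain c where c: "c \<in> charts_at Q q" using exists_chart_at[OF Q q(1)] .
  show ?thesis using that[of c] ext_chart_at[OF c q(2)] c by (simp add: zp charts_at_iff)
qed

lemma exists_phase_time_chart:
  assumes "m \<in> points (phase_time Q)"
  obtains c where "c \<in> charts Q" "m \<in> fst (phase_time_chart c)" "phase_time_chart c \<in> charts_at (phase_time Q) m"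
proof -
  obtain q p t where mp: "m = ((q, p), t)" by (metis surj_pair)
  have q: "q \<in> points Q" "p \<in> cotangent_space Q q"
    using assms by (simp_all add: mp points_phase_time)
  obtain c where c: "c \<in> charts_at Q q" using exists_chart_at[OF Q q(1)] .
  show ?thesis using that[of c] phase_time_chart_at[OF c q(2)] c q by (simp add: mp charts_at_iff)
qed

lemma phase_time_chart_in: "c \<in> charts Q \<Longrightarrow> m \<in> fst (phase_time_chart c) \<Longrightarrow> phase_time_chart c \<in> charts_at (phase_time Q) m"
  using phase_time_chart_at[of c "fst (fst m)" "snd (fst m)" "snd m"]
  by (simp add: charts_at_iff mem_Times_iff) (metis SigmaE fst_conv snd_conv)

lemma ext_chart_in: "c \<in> charts Q \<Longrightarrow> z \<in> fst (ext_chart c) \<Longrightarrow> ext_chart c \<in> charts_at (ext_phase_space Q) z"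
  using ext_chart_at[of c "fst (fst z)" "snd z" "snd (fst z)"] by (auto simp: charts_at_iff)

lemma proj_mu_point: "z \<in> points (ext_phase_space Q) \<Longrightarrow> proj_mu Q z \<in> points (phase_time Q)"
  by (metis exists_ext_chart proj_mu_chart(1) phase_time_chart_in charts_at_point[OF atlas_phase_time])

lemma ext_point_point: "m \<in> points (phase_time Q) \<Longrightarrow> ext_point m u \<in> points (ext_phase_space Q)"
  by (metis exists_phase_time_chart ext_point_chart(1) ext_chart_in charts_at_point[OF atlas_ext_phase_space])

lemma proj_mu_ext_point: "proj_mu Q (ext_point m u) = m" if m: "m \<in> points (phase_time Q)"
proof -
  obtain c where c: "c \<in> charts Q" "m \<in> fst (phase_time_chart c)" "phase_time_chart c \<in> charts_at (phase_time Q) m"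
    using exists_phase_time_chart[OF m] .
  note l = ext_point_chart[OF c(1,2), of u]
  note pl = proj_mu_chart[OF c(1) l(1)]
  show ?thesis
    by (rule chart_eqD[OF atlas_phase_time conjunct1[OF c(3)[unfolded charts_at_iff]] pl(1) c(2)])
      (simp only: pl(2) l(2) split_beta fst_conv snd_conv prod.collapse)
qed

lemma coord_u_ext_point: "coord_u Q (ext_point m u) = u" if m: "m \<in> points (phase_time Q)"
proof -
  obtain c where c: "c \<in> charts Q" "m \<in> fst (phase_time_chart c)"
    using exists_phase_time_chart[OF m] by metis
  note l = ext_point_chart[OF c, of u]
  show ?thesis using proj_mu_chart(3)[OF c(1) l(1)] by (simp only: l(2) split_beta fst_conv snd_conv)
qed

lemma ext_point_proj_mu: "ext_point (proj_mu Q z) (coord_u Q z) = z" if z: "z \<in> points (ext_phase_space Q)"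
proof -
  obtain c where c: "c \<in> charts Q" "z \<in> fst (ext_chart c)" "ext_chart c \<in> charts_at (ext_phase_space Q) z"
    using exists_ext_chart[OF z] .
  note pl = proj_mu_chart[OF c(1,2)]
  note l = ext_point_chart[OF c(1) pl(1), of "coord_u Q z"]
  show ?thesis
    by (rule chart_eqD[OF atlas_ext_phase_space conjunct1[OF c(3)[unfolded charts_at_iff]] l(1) c(2)])
      (simp only: pl(2) l(2) split_beta fst_conv snd_conv, simp only: pl(3) prod.collapse)
qed

lemma smooth_proj_mu: "smooth_map (ext_phase_space Q) (phase_time Q) (proj_mu Q)"
proof (rule smooth_map_linear_in_charts[OF atlas_ext_phase_space atlas_phase_time])
  show "bounded_linear (\<lambda>y :: ('e \<times> real) \<times> ('e \<times> real). case y of ((x, t), (\<xi>, u)) \<Rightarrow> ((x, \<xi>), t))"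
    unfolding split_beta
    by (intro bounded_linear_Pair bounded_linear_compose[OF bounded_linear_fst] bounded_linear_compose[OF bounded_linear_snd]
        bounded_linear_fst bounded_linear_snd)
  fix z assume "z \<in> points (ext_phase_space Q)"
  then obtain c where c: "c \<in> charts Q" "z \<in> fst (ext_chart c)" "ext_chart c \<in> charts_at (ext_phase_space Q) z"
    by (rule exists_ext_chart)
  show "\<exists>c\<in>charts_at (ext_phase_space Q) z. \<exists>d\<in>charts_at (phase_time Q) (proj_mu Q z).
      \<forall>y\<in>fst c. proj_mu Q y \<in> fst d \<and>
        snd d (proj_mu Q y) = (case snd c y of ((x, t), (\<xi>, u)) \<Rightarrow> ((x, \<xi>), t))"
    by (intro bexI[OF _ c(3)] bexI[OF _ phase_time_chart_in[OF c(1) proj_mu_chart(1)[OF c(1,2)]]] ballI conjI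
        proj_mu_chart[OF c(1)])
qed

lemma smooth_coord_u: "smooth_map (ext_phase_space Q) real_line (coord_u Q)"
proof (rule smooth_map_linear_in_charts[OF atlas_ext_phase_space smooth_atlas_real_line])
  show "bounded_linear (\<lambda>y :: ('e \<times> real) \<times> ('e \<times> real). snd (snd y))"
    by (intro bounded_linear_compose[OF bounded_linear_snd] bounded_linear_snd)
  fix z assume "z \<in> points (ext_phase_space Q)"
  then obtain c where c: "c \<in> charts Q" "z \<in> fst (ext_chart c)" "ext_chart c \<in> charts_at (ext_phase_space Q) z"
    by (rule exists_ext_chart)
  show "\<exists>c\<in>charts_at (ext_phase_space Q) z. \<exists>d\<in>charts_at real_line (coord_u Q z).
      \<forall>y\<in>fst c. coord_u Q y \<in> fst d \<and> snd d (coord_u Q y) = snd (snd (snd c y))"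
    by (intro bexI[OF _ c(3)] bexI[of _ real_chart] ballI conjI) (simp_all only: proj_mu_chart(3)[OF c(1)] fst_conv snd_conv UNIV_I charts_at_real_line singletonI)
qed

lemma smooth_ext_point: "smooth_map (product_manifold (phase_time Q) real_line) (ext_phase_space Q) (\<lambda>y. ext_point (fst y) (snd y))"
proof (rule smooth_map_linear_in_charts[OF smooth_atlas_product[OF atlas_phase_time smooth_atlas_real_line] atlas_ext_phase_space])
  show "bounded_linear (\<lambda>y :: (('e \<times> 'e) \<times> real) \<times> real. case fst y of ((x, \<xi>), t) \<Rightarrow> ((x, t), (\<xi>, snd y)))"
    unfolding split_beta
    by (intro bounded_linear_Pair bounded_linear_compose[OF bounded_linear_fst] bounded_linear_compose[OF bounded_linear_snd]
        bounded_linear_fst bounded_linear_snd)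
  fix y assume y: "y \<in> points (product_manifold (phase_time Q) real_line)"
  then have "fst y \<in> points (phase_time Q)" by auto
  then obtain c where c: "c \<in> charts Q" "fst y \<in> fst (phase_time_chart c)" "phase_time_chart c \<in> charts_at (phase_time Q) (fst y)"
    by (rule exists_phase_time_chart)
  have d: "product_chart (phase_time_chart c) real_chart \<in> charts_at (product_manifold (phase_time Q) real_line) y"
    using product_chart_at[OF c(3), of real_chart real_line "snd y"] by simp
  show "\<exists>c\<in>charts_at (product_manifold (phase_time Q) real_line) y. \<exists>d\<in>charts_at (ext_phase_space Q) (ext_point (fst y) (snd y)).
      \<forall>y\<in>fst c. ext_point (fst y) (snd y) \<in> fst d \<and>
        snd d (ext_point (fst y) (snd y)) = (case fst (snd c y) of ((x, \<xi>), t) \<Rightarrow> ((x, t), (\<xi>, snd (snd c y))))"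
  proof (intro bexI[OF _ d] bexI[OF _ ext_chart_in[OF c(1) ext_point_chart(1)[OF c(1,2)]]] ballI conjI)
    fix y' assume "y' \<in> fst (product_chart (phase_time_chart c) real_chart)"
    then have y': "fst y' \<in> fst (phase_time_chart c)" by (auto simp: mem_Times_iff)
    show "ext_point (fst y') (snd y') \<in> fst (ext_chart c)" by (rule ext_point_chart(1)[OF c(1) y'])
    show "snd (ext_chart c) (ext_point (fst y') (snd y')) =
        (case fst (snd (product_chart (phase_time_chart c) real_chart) y') of
          ((x, \<xi>), t) \<Rightarrow> ((x, t), (\<xi>, snd (snd (product_chart (phase_time_chart c) real_chart) y'))))"
      unfolding ext_point_chart(2)[OF c(1) y'] by (simp add: split_beta)
  qed
qed

text \<open>
  The only property of the canonical form that the main argument needs.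
\<close>

lemma canonical_form_zero:
  assumes z: "z \<in> points (cotangent_bundle Q)" and d: "d \<in> charts_at (cotangent_bundle Q) z"
  shows "canonical_form Q z (tangent_vector (cotangent_bundle Q) z d 0) Y = 0"
proof -
  let ?c = "SOME c. c \<in> charts_at Q (fst z)"
  have q: "fst z \<in> points Q" "snd z \<in> cotangent_space Q (fst z)" using z by auto
  then have "?c \<in> charts_at Q (fst z)" by (metis exists_chart_at[OF Q] someI)
  then have c: "cotangent_chart Q ?c \<in> charts_at (cotangent_bundle Q) z"
    using cotangent_chart_at[of ?c Q "fst z" "snd z"] q by simp
  have "coordinates (cotangent_chart Q ?c) (tangent_vector (cotangent_bundle Q) z d 0) = 0"
    using linear_0[OF linear_transition_derivative[OF smooth_atlas_cotangent_bundle[OF Q] d c]]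
    by (simp add: coordinates_tangent_vector[OF c])
  then show ?thesis by (simp add: canonical_form_def Let_def split_beta)
qed

lemma omega_tilde_zero:
  assumes d: "d \<in> charts_at (phase_time Q) m"
  shows "omega_tilde Q m (tangent_vector (phase_time Q) m d 0) Y = 0"
proof -
  note B = smooth_atlas_cotangent_bundle[OF Q]
  have f: "smooth_map (phase_time Q) (cotangent_bundle Q) fst"
    unfolding phase_time_def by (rule smooth_map_fst[OF B smooth_atlas_real_line])
  have pt: "fst m \<in> points (cotangent_bundle Q)"
    by (rule smooth_map_point[OF f charts_at_point[OF atlas_phase_time d]])
  obtain e where e: "e \<in> charts_at (cotangent_bundle Q) (fst m)" using exists_chart_at[OF B pt] .
  show ?thesis
    unfolding omega_tilde_def pullback_def differential_tangent_vector[OF atlas_phase_time B f d e]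
      linear_0[OF has_derivative_linear[OF coordinate_has_derivative[OF f d e]]]
    by (rule canonical_form_zero[OF pt e])
qed

end

lemma unit_speed_imp_translation:
  fixes g :: "real \<Rightarrow> real"
  assumes "\<And>s. (g has_real_derivative 1) (at s)"
  shows "g s = s + g 0"
proof -
  have "((\<lambda>s. g s - s) has_real_derivative 0) (at s)" for s
    using DERIV_diff[OF assms DERIV_ident] by simp
  then have "g s - s = g 0 - 0" by (intro DERIV_isconst_all) blast
  then show ?thesis by simp
qed

section \<open>Symplectic maps that cover a map of phase space with time\<close>

context
  fixes Q :: "('q, 'e::finite_dim_inner) manifold"
  assumes Q: "smooth_atlas Q"
begin

abbreviation (input) "P \<equiv> phase_time Q"
abbreviation (input) "E \<equiv> ext_phase_space Q"

lemmas P = atlas_phase_time[OF Q]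
lemmas E = atlas_ext_phase_space[OF Q]
lemmas R = smooth_atlas_real_line

lemma smooth_time_pt: "smooth_map P real_line time_pt"
proof -
  have "(time_pt :: ('q, 'e) phase_time_point \<Rightarrow> real) = snd" by (simp add: fun_eq_iff time_pt_def)
  then show ?thesis
    using smooth_map_snd[OF smooth_atlas_cotangent_bundle[OF Q] R] by (simp add: phase_time_def)
qed

lemma time_ext_eq: "time_ext = (\<lambda>z. time_pt (proj_mu Q z))"
  by (simp add: fun_eq_iff time_ext_def time_pt_def proj_mu_def split_beta)

lemma smooth_time_ext: "smooth_map E real_line time_ext"
  unfolding time_ext_eq by (rule smooth_map_compose[OF E P R smooth_proj_mu[OF Q] smooth_time_pt])

text \<open>
  The form \<open>\<Omega>\<^sub>0\<close> on vectors that are pushed forward along a map \<open>F\<close> depends on \<open>\<mu> \<circ> F\<close>, \<open>u \<circ> F\<close> and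
  \<open>t \<circ> F\<close> only. The main argument uses it for \<open>\<psi>\<close>, for the section \<open>u = 0\<close>, and for their composition.
\<close>

lemma Omega_ext_differential:
  fixes M :: "('m, 'f::finite_dim_inner) manifold"
  assumes M: "smooth_atlas M" and F: "smooth_map M E F"
    and X: "X \<in> tangent_space M x" and Y: "Y \<in> tangent_space M x"
  shows "Omega_ext Q (F x) (differential M E F x X) (differential M E F x Y) =
    omega_tilde Q (proj_mu Q (F x)) (differential M P (\<lambda>x. proj_mu Q (F x)) x X)
      (differential M P (\<lambda>x. proj_mu Q (F x)) x Y) +
    wedge (d_fun (\<lambda>x. coord_u Q (F x))) (d_fun (\<lambda>x. time_ext (F x))) x X Y"
proof -
  note \<mu> = smooth_proj_mu[OF Q]
  note u = smooth_coord_u[OF Q]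
  note \<mu>F = smooth_map_compose[OF M E P F \<mu>]
  note uF = smooth_map_compose[OF M E R F u]
  note tF = smooth_map_compose[OF M E R F smooth_time_ext]
  show ?thesis
    by (simp add: Omega_ext_def pullback_def wedge_def differential_compose[OF M E P F \<mu> \<mu>F]
      d_fun_differential[OF M E F u uF] d_fun_differential[OF M E F smooth_time_ext tF] X Y)
qed

text \<open>
  This is how the constancy of the time step enters: it gives \<open>d(t \<circ> \<psi>) = dt\<close>.
\<close>

lemma d_fun_time_shift:
  fixes M :: "('m, 'f::finite_dim_inner) manifold"
  assumes M: "smooth_atlas M" and f: "smooth_map M real_line f" and g: "smooth_map M real_line g"
    and fg: "\<And>x. x \<in> points M \<Longrightarrow> f x = g x + h" and X: "X \<in> tangent_space M x"
  shows "d_fun f x X = d_fun g x X"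
proof -
  have h: "smooth_map M real_line (\<lambda>_. h)" by (rule smooth_map_const[OF M R]) simp
  note gh = smooth_map_add[OF M g h]
  show ?thesis
    using d_fun_cong[OF M f gh fg X] d_fun_add[OF M g h gh X] d_fun_const[OF M X h] by simp
qed

lemma smooth_ext_point_compose:
  fixes M :: "('m, 'f::finite_dim_inner) manifold"
  assumes M: "smooth_atlas M" and f: "smooth_map M P f" and g: "smooth_map M real_line g"
  shows "smooth_map M E (\<lambda>x. ext_point Q (f x) (g x))"
  using smooth_map_compose[OF M smooth_atlas_product[OF P R] E smooth_map_Pair[OF M P R f g] smooth_ext_point[OF Q]]
  by simp

lemma omega_tilde_const:
  fixes M :: "('m, 'f::finite_dim_inner) manifold"
  assumes M: "smooth_atlas M" and m: "m \<in> points P" and X: "X \<in> tangent_space M x"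
  shows "omega_tilde Q m (differential M P (\<lambda>_. m) x X) Y = 0"
proof -
  obtain d where d: "d \<in> charts_at P m" using exists_chart_at[OF P m] .
  show ?thesis
    unfolding differential_const[OF M P smooth_map_const[OF M P m] X d]
    by (rule omega_tilde_zero[OF Q d])
qed

context
  fixes \<phi> :: "('q, 'e) phase_time_point \<Rightarrow> ('q, 'e) phase_time_point"
    and \<psi> :: "('q, 'e) ext_phase_point \<Rightarrow> ('q, 'e) ext_phase_point" and h :: real
  assumes \<phi>: "smooth_map P P \<phi>" and \<psi>: "smooth_map E E \<psi>"
    and time_step: "\<And>m. m \<in> points P \<Longrightarrow> time_pt (\<phi> m) = time_pt m + h"
    and fibred: "\<And>z. z \<in> points E \<Longrightarrow> proj_mu Q (\<psi> z) = \<phi> (proj_mu Q z)"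
begin

lemma time_ext_psi: "z \<in> points E \<Longrightarrow> time_ext (\<psi> z) = time_ext z + h"
  by (simp add: time_ext_eq fibred time_step proj_mu_point[OF Q])

text \<open>
  Compare \<open>\<psi>\<^sup>*\<Omega>\<^sub>0\<close> and \<open>\<Omega>\<^sub>0\<close> on \<open>X = \<partial>/\<partial>u\<close> and a vector \<open>Y\<close> with \<open>dt(Y) = 1\<close>. Since \<open>\<mu>\<close> and \<open>\<mu> \<circ> \<psi> = \<phi> \<circ> \<mu>\<close> are
  constant along the fibre, the terms with \<open>\<omega>\<close> vanish, and what remains is
  \<open>d(u \<circ> \<psi>)(X) dt(Y) = du(X) dt(Y)\<close>.
\<close>

lemma fibre_derivative:
  assumes sympl: "eq_2form E (pullback E E \<psi> (Omega_ext Q)) (Omega_ext Q)" and m: "m \<in> points P"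
  shows "((\<lambda>s. coord_u Q (\<psi> (ext_point Q m s))) has_real_derivative 1) (at s)"
proof -
  define z where "z = ext_point Q m s"
  define \<sigma> where "\<sigma> = ext_point Q m"
  define \<rho> where "\<rho> r = ext_point Q (fst m, r) s" for r
  have mr: "(fst m, r) \<in> points P" for r
    using m by (cases m) (auto simp: phase_time_def)
  have t: "smooth_map real_line P (\<lambda>r. (fst m, r))"
  proof -
    have "fst m \<in> points (cotangent_bundle Q)" using m by (cases m) (auto simp: phase_time_def)
    then show ?thesis unfolding phase_time_def
      by (intro smooth_map_Pair[OF R smooth_atlas_cotangent_bundle[OF Q] R]
          smooth_map_const[OF R smooth_atlas_cotangent_bundle[OF Q]] smooth_map_id R)
  qed
  have \<sigma>: "smooth_map real_line E \<sigma>" unfolding \<sigma>_def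
    by (rule smooth_ext_point_compose[OF R smooth_map_const[OF R P m] smooth_map_id[OF R]])
  have \<rho>: "smooth_map real_line E \<rho>" unfolding \<rho>_def
    by (rule smooth_ext_point_compose[OF R t smooth_map_const[OF R R]]) simp
  have z: "z \<in> points E" "\<sigma> s = z" "\<rho> (snd m) = z"
    using ext_point_point[OF Q m] by (simp_all add: z_def \<sigma>_def \<rho>_def)
  have \<sigma>E: "\<sigma> r \<in> points E" and \<rho>E: "\<rho> r \<in> points E" for r
    using ext_point_point[OF Q] m mr by (simp_all add: \<sigma>_def \<rho>_def)
  \<comment> \<open>\<open>X\<close> and \<open>Y\<close> are the velocities at \<open>z\<close> of the curves \<open>\<sigma>\<close> and \<open>\<rho>\<close>, along which only \<open>u\<close>, respectively \<open>t\<close>, varies.\<close>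
  define X where "X = differential real_line E \<sigma> s (unit_tangent s)"
  define Y where "Y = differential real_line E \<rho> (snd m) (unit_tangent (snd m))"
  have X: "X \<in> tangent_space E z" and Y: "Y \<in> tangent_space E z"
    unfolding X_def Y_def
    using differential_in_tangent_space[OF R E \<sigma> unit_tangent_in_tangent_space, of s]
      differential_in_tangent_space[OF R E \<rho> unit_tangent_in_tangent_space, of "snd m"] z by simp_all
  have dX: "d_fun f z X = d_fun (\<lambda>r. f (\<sigma> r)) s (unit_tangent s)" if f: "smooth_map E real_line f" for f
    using d_fun_differential[OF R E \<sigma> f smooth_map_compose[OF R E R \<sigma> f] unit_tangent_in_tangent_space, of s]
    by (simp add: X_def z)
  have dY: "d_fun f z Y = d_fun (\<lambda>r. f (\<rho> r)) (snd m) (unit_tangent (snd m))" if f: "smooth_map E real_line f" for f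
    using d_fun_differential[OF R E \<rho> f smooth_map_compose[OF R E R \<rho> f] unit_tangent_in_tangent_space, of "snd m"]
    by (simp add: Y_def z)
  have const: "d_fun (\<lambda>_. a) r (unit_tangent r) = 0" for a r
    by (rule d_fun_const[OF R unit_tangent_in_tangent_space smooth_map_const[OF R R]]) simp
  note u = smooth_coord_u[OF Q]
  note u\<psi> = smooth_map_compose[OF E E R \<psi> u]
  note t\<psi> = smooth_map_compose[OF E E R \<psi> smooth_time_ext]
  have duX: "d_fun (coord_u Q) z X = 1"
    unfolding dX[OF u] by (simp add: \<sigma>_def coord_u_ext_point[OF Q m] d_fun_id_unit_tangent)
  have dtX: "d_fun time_ext z X = 0"
    unfolding dX[OF smooth_time_ext] by (simp add: \<sigma>_def time_ext_eq proj_mu_ext_point[OF Q m] const)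
  have dtY: "d_fun time_ext z Y = 1"
    unfolding dY[OF smooth_time_ext]
    by (simp add: \<rho>_def time_ext_eq proj_mu_ext_point[OF Q mr] time_pt_def d_fun_id_unit_tangent)
  have dt\<psi>: "d_fun (\<lambda>z. time_ext (\<psi> z)) z V = d_fun time_ext z V" if "V \<in> tangent_space E z" for V
    by (rule d_fun_time_shift[OF E t\<psi> smooth_time_ext time_ext_psi that])
  note \<mu> = smooth_proj_mu[OF Q]
  note \<mu>\<psi> = smooth_map_compose[OF E E P \<psi> \<mu>]
  have \<mu>X: "differential E P (proj_mu Q) z X = differential real_line P (\<lambda>_. m) s (unit_tangent s)"
    using differential_compose[OF R E P \<sigma> \<mu> smooth_map_compose[OF R E P \<sigma> \<mu>] unit_tangent_in_tangent_space, of s]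
    by (simp add: X_def z) (simp add: \<sigma>_def proj_mu_ext_point[OF Q m])
  have \<mu>\<psi>X: "differential E P (\<lambda>z. proj_mu Q (\<psi> z)) z X = differential real_line P (\<lambda>_. \<phi> m) s (unit_tangent s)"
    using differential_compose[OF R E P \<sigma> \<mu>\<psi> smooth_map_compose[OF R E P \<sigma> \<mu>\<psi>] unit_tangent_in_tangent_space, of s]
    by (simp add: X_def z fibred \<sigma>E) (simp add: \<sigma>_def proj_mu_ext_point[OF Q m])
  have "proj_mu Q z = m" by (simp add: z_def proj_mu_ext_point[OF Q m])
  then have \<omega>: "omega_tilde Q (proj_mu Q z) (differential E P (proj_mu Q) z X) V = 0"
    and \<omega>\<psi>: "omega_tilde Q (proj_mu Q (\<psi> z)) (differential E P (\<lambda>z. proj_mu Q (\<psi> z)) z X) V = 0" for V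
    unfolding \<mu>X \<mu>\<psi>X fibred[OF z(1)]
    using omega_tilde_const[OF R m unit_tangent_in_tangent_space]
      omega_tilde_const[OF R smooth_map_point[OF \<phi> m] unit_tangent_in_tangent_space] by simp_all
  have "pullback E E \<psi> (Omega_ext Q) z X Y = Omega_ext Q z X Y"
    using sympl z X Y by (simp add: eq_2form_def)
  moreover have "pullback E E \<psi> (Omega_ext Q) z X Y = d_fun (\<lambda>z. coord_u Q (\<psi> z)) z X"
    by (simp add: pullback_def Omega_ext_differential[OF E \<psi> X Y] \<omega>\<psi> wedge_def dt\<psi> X Y dtX dtY)
  moreover have "Omega_ext Q z X Y = 1"
    by (simp add: Omega_ext_def pullback_def \<omega> wedge_def dtX dtY duX)
  ultimately have "d_fun (\<lambda>r. coord_u Q (\<psi> (\<sigma> r))) s (unit_tangent s) = 1"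
    using dX[OF u\<psi>] by simp
  then show ?thesis
    using has_derivative_d_fun_unit_tangent[OF smooth_map_compose[OF R E R \<sigma> u\<psi>], of s]
    by (simp add: \<sigma>_def)
qed

text \<open>
  Along each fibre, which is parametrised by \<open>u\<close>, the function \<open>u \<circ> \<psi>\<close> has derivative 1.
\<close>

lemma coord_u_psi:
  assumes sympl: "eq_2form E (pullback E E \<psi> (Omega_ext Q)) (Omega_ext Q)" and z: "z \<in> points E"
  shows "coord_u Q (\<psi> z) = coord_u Q z + coord_u Q (\<psi> (ext_point Q (proj_mu Q z) 0))"
  using unit_speed_imp_translation[OF fibre_derivative[OF sympl proj_mu_point[OF Q z]], of "coord_u Q z"]
  by (simp add: ext_point_proj_mu[OF Q z])

text \<open>
  Pull \<open>\<psi>\<^sup>*\<Omega>\<^sub>0 = \<Omega>\<^sub>0\<close> back along the section \<open>\<iota> : m \<mapsto> (m, 0)\<close>. On the left \<open>\<mu> \<circ> \<psi> \<circ> \<iota> = \<phi>\<close> and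
  \<open>u \<circ> \<psi> \<circ> \<iota> = W\<close>, so this becomes \<open>\<phi>\<^sup>*\<omega> + dW \<and> dt\<close>; on the right \<open>\<mu> \<circ> \<iota>\<close> is the identity and
  \<open>u \<circ> \<iota> = 0\<close>, which leaves \<open>\<omega>\<close>.
\<close>

lemma pullback_omega_tilde:
  assumes sympl: "eq_2form E (pullback E E \<psi> (Omega_ext Q)) (Omega_ext Q)"
    and W: "W = (\<lambda>m. coord_u Q (\<psi> (ext_point Q m 0)))"
  shows "smooth_map P real_line W"
    and "eq_2form P (pullback P P \<phi> (omega_tilde Q)) (omega_tilde Q - wedge (d_fun W) (d_fun time_pt))"
proof -
  define \<iota> where "\<iota> m = ext_point Q m 0" for m
  have zero: "smooth_map P real_line (\<lambda>_. 0)" by (rule smooth_map_const[OF P R]) simp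
  have \<iota>: "smooth_map P E \<iota>" unfolding \<iota>_def
    by (rule smooth_ext_point_compose[OF P smooth_map_id[OF P] zero])
  note \<psi>\<iota> = smooth_map_compose[OF P E E \<iota> \<psi>]
  note t\<psi>\<iota> = smooth_map_compose[OF P E R \<psi>\<iota> smooth_time_ext]
  have W': "W = (\<lambda>m. coord_u Q (\<psi> (\<iota> m)))" by (simp add: W \<iota>_def)
  show smW: "smooth_map P real_line W"
    unfolding W' by (rule smooth_map_compose[OF P E R \<psi>\<iota> smooth_coord_u[OF Q]])
  show "eq_2form P (pullback P P \<phi> (omega_tilde Q)) (omega_tilde Q - wedge (d_fun W) (d_fun time_pt))"
    unfolding eq_2form_def
  proof (intro ballI)
    fix m X Y assume m: "m \<in> points P" and X: "X \<in> tangent_space P m" and Y: "Y \<in> tangent_space P m"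
    have \<iota>m: "\<iota> m \<in> points E" if "m \<in> points P" for m using ext_point_point[OF Q that] by (simp add: \<iota>_def)
    have \<mu>\<iota>: "proj_mu Q (\<iota> m) = m" if "m \<in> points P" for m using proj_mu_ext_point[OF Q that] by (simp add: \<iota>_def)
    have D\<psi>: "differential P P (\<lambda>m. proj_mu Q (\<psi> (\<iota> m))) m V = differential P P \<phi> m V"
      if "V \<in> tangent_space P m" for V
      by (rule differential_cong[OF P _ that]) (simp add: fibred \<iota>m \<mu>\<iota>)
    have D: "differential P P (\<lambda>m. proj_mu Q (\<iota> m)) m V = V" if V: "V \<in> tangent_space P m" for V
      by (rule trans[OF differential_cong[OF P _ V] differential_id[OF P V]]) (simp add: \<mu>\<iota>)
    have dt: "d_fun (\<lambda>m. time_ext (\<psi> (\<iota> m))) m V = d_fun time_pt m V" if V: "V \<in> tangent_space P m" for V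
      by (rule d_fun_time_shift[OF P t\<psi>\<iota> smooth_time_pt _ V])
        (simp add: time_ext_psi \<iota>m, simp add: time_ext_eq \<mu>\<iota>)
    have du: "d_fun (\<lambda>m. coord_u Q (\<iota> m)) m V = 0" if V: "V \<in> tangent_space P m" for V
      using d_fun_cong[OF P smooth_map_compose[OF P E R \<iota> smooth_coord_u[OF Q]] zero _ V]
        d_fun_const[OF P V zero] coord_u_ext_point[OF Q] by (simp add: \<iota>_def)
    have "Omega_ext Q (\<psi> (\<iota> m)) (differential E E \<psi> (\<iota> m) (differential P E \<iota> m X))
          (differential E E \<psi> (\<iota> m) (differential P E \<iota> m Y)) =
        Omega_ext Q (\<iota> m) (differential P E \<iota> m X) (differential P E \<iota> m Y)"
      using sympl \<iota>m[OF m] differential_in_tangent_space[OF P E \<iota> X] differential_in_tangent_space[OF P E \<iota> Y]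
      by (simp add: eq_2form_def pullback_def)
    then have "omega_tilde Q (\<phi> m) (differential P P \<phi> m X) (differential P P \<phi> m Y) +
        wedge (d_fun W) (d_fun time_pt) m X Y = omega_tilde Q m X Y"
      unfolding differential_compose[OF P E E \<iota> \<psi> \<psi>\<iota> X] differential_compose[OF P E E \<iota> \<psi> \<psi>\<iota> Y]
        Omega_ext_differential[OF P \<psi>\<iota> X Y] Omega_ext_differential[OF P \<iota> X Y]
      by (simp add: D\<psi> D X Y wedge_def dt du fibred \<iota>m \<mu>\<iota> m W')
    then show "pullback P P \<phi> (omega_tilde Q) m X Y =
        (omega_tilde Q - wedge (d_fun W) (d_fun time_pt)) m X Y"
      by (simp add: pullback_def fun_diff_def)
  qed
qed

text \<open>
  The assumption on \<open>\<phi>\<^sup>*\<omega>\<close>, pulled back along \<open>\<mu>\<close>, is used on the vectors \<open>d\<mu>(X)\<close> and \<open>d\<mu>(Y)\<close>; the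
  term \<open>dW \<and> dt\<close> cancels against the one that comes from \<open>d(u \<circ> \<psi>) = du + d(W \<circ> \<mu>)\<close>.
\<close>

lemma symplectic_if_pullback_omega_tilde:
  assumes W: "smooth_map P real_line W"
    and \<omega>: "eq_2form P (pullback P P \<phi> (omega_tilde Q)) (omega_tilde Q - wedge (d_fun W) (d_fun time_pt))"
    and u: "\<And>z. z \<in> points E \<Longrightarrow> coord_u Q (\<psi> z) = coord_u Q z + W (proj_mu Q z)"
  shows "eq_2form E (pullback E E \<psi> (Omega_ext Q)) (Omega_ext Q)"
  unfolding eq_2form_def
proof (intro ballI)
  fix z X Y assume z: "z \<in> points E" and X: "X \<in> tangent_space E z" and Y: "Y \<in> tangent_space E z"
  note \<mu> = smooth_proj_mu[OF Q]
  note cu = smooth_coord_u[OF Q]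
  note W\<mu> = smooth_map_compose[OF E P R \<mu> W]
  note uW = smooth_map_add[OF E cu W\<mu>]
  have D: "differential E P (\<lambda>z. proj_mu Q (\<psi> z)) z V = differential P P \<phi> (proj_mu Q z) (differential E P (proj_mu Q) z V)"
    if V: "V \<in> tangent_space E z" for V
    using differential_cong[OF E _ V, of "\<lambda>z. proj_mu Q (\<psi> z)" "\<lambda>z. \<phi> (proj_mu Q z)"]
      differential_compose[OF E P P \<mu> \<phi> smooth_map_compose[OF E P P \<mu> \<phi>] V] fibred by simp
  have du: "d_fun (\<lambda>z. coord_u Q (\<psi> z)) z V =
      d_fun (coord_u Q) z V + d_fun W (proj_mu Q z) (differential E P (proj_mu Q) z V)"
    if V: "V \<in> tangent_space E z" for V
    using d_fun_cong[OF E smooth_map_compose[OF E E R \<psi> cu] uW u V]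
      d_fun_add[OF E cu W\<mu> uW V] d_fun_differential[OF E P \<mu> W W\<mu> V] by simp
  have dt: "d_fun (\<lambda>z. time_ext (\<psi> z)) z V = d_fun time_ext z V" if V: "V \<in> tangent_space E z" for V
    by (rule d_fun_time_shift[OF E smooth_map_compose[OF E E R \<psi> smooth_time_ext] smooth_time_ext time_ext_psi V])
  have dt': "d_fun time_pt (proj_mu Q z) (differential E P (proj_mu Q) z V) = d_fun time_ext z V"
    if V: "V \<in> tangent_space E z" for V
    unfolding time_ext_eq
    by (rule d_fun_differential[OF E P \<mu> smooth_time_pt smooth_map_compose[OF E P R \<mu> smooth_time_pt] V])
  let ?X = "differential E P (proj_mu Q) z X" and ?Y = "differential E P (proj_mu Q) z Y"
  have "pullback P P \<phi> (omega_tilde Q) (proj_mu Q z) ?X ?Y =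
      omega_tilde Q (proj_mu Q z) ?X ?Y - wedge (d_fun W) (d_fun time_pt) (proj_mu Q z) ?X ?Y"
    using \<omega> proj_mu_point[OF Q z] differential_in_tangent_space[OF E P \<mu> X] differential_in_tangent_space[OF E P \<mu> Y]
    by (simp add: eq_2form_def fun_diff_def)
  then show "pullback E E \<psi> (Omega_ext Q) z X Y = Omega_ext Q z X Y"
    by (simp add: pullback_def Omega_ext_differential[OF E \<psi> X Y] D X Y fibred[OF z])
      (simp add: Omega_ext_def pullback_def wedge_def du dt dt' X Y algebra_simps)
qed

text \<open>
  The inverse maps the point of \<open>E\<close> over \<open>m\<close> with coordinate \<open>u\<close> to the point over \<open>\<phi>\<^sup>-\<^sup>1 m\<close> with
  coordinate \<open>u - W (\<phi>\<^sup>-\<^sup>1 m)\<close>.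
\<close>

lemma diffeomorphism_psi:
  assumes dphi: "diffeomorphism P P \<phi>" and W: "smooth_map P real_line W"
    and u: "\<And>z. z \<in> points E \<Longrightarrow> coord_u Q (\<psi> z) = coord_u Q z + W (proj_mu Q z)"
  shows "diffeomorphism E E \<psi>"
proof -
  define \<phi>' where "\<phi>' = inv_into (points P) \<phi>"
  have \<phi>': "smooth_map P P \<phi>'" and bij: "bij_betw \<phi> (points P) (points P)"
    using dphi by (simp_all add: diffeomorphism_def \<phi>'_def)
  have inv: "\<phi> (\<phi>' m) = m" "\<phi>' m \<in> points P" if "m \<in> points P" for m
    using bij_betw_inv_into_right[OF bij that] smooth_map_point[OF \<phi>' that] by (simp_all add: \<phi>'_def)
  define G where "G z = ext_point Q (\<phi>' (proj_mu Q z)) (coord_u Q z - W (\<phi>' (proj_mu Q z)))" for z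
  note \<mu> = smooth_proj_mu[OF Q]
  note \<phi>'\<mu> = smooth_map_compose[OF E P P \<mu> \<phi>']
  have G: "smooth_map E E G" unfolding G_def
    by (rule smooth_ext_point_compose[OF E \<phi>'\<mu> smooth_map_diff[OF E smooth_coord_u[OF Q] smooth_map_compose[OF E P R \<phi>'\<mu> W]]])
  note eqI = ext_point_proj_mu[OF Q]
  have inj: "inj_on \<psi> (points E)"
  proof (rule inj_onI)
    fix z z' assume z: "z \<in> points E" "z' \<in> points E" and eq: "\<psi> z = \<psi> z'"
    have "\<phi> (proj_mu Q z) = \<phi> (proj_mu Q z')" using fibred[OF z(1)] fibred[OF z(2)] eq by simp
    then have \<mu>eq: "proj_mu Q z = proj_mu Q z'"
      using bij proj_mu_point[OF Q z(1)] proj_mu_point[OF Q z(2)] by (auto simp: bij_betw_def dest: inj_onD)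
    then have "coord_u Q z = coord_u Q z'" using u[OF z(1)] u[OF z(2)] eq by simp
    then show "z = z'" using eqI[OF z(1)] eqI[OF z(2)] \<mu>eq by metis
  qed
  have \<psi>G: "\<psi> (G z) = z" if z: "z \<in> points E" for z
  proof -
    note m = inv[OF proj_mu_point[OF Q z]]
    have Gz: "G z \<in> points E" by (rule smooth_map_point[OF G z])
    have \<mu>G: "proj_mu Q (G z) = \<phi>' (proj_mu Q z)" by (simp add: G_def proj_mu_ext_point[OF Q m(2)])
    have "proj_mu Q (\<psi> (G z)) = proj_mu Q z" using fibred[OF Gz] m \<mu>G by simp
    moreover have "coord_u Q (\<psi> (G z)) = coord_u Q z"
      using u[OF Gz] \<mu>G by (simp add: G_def coord_u_ext_point[OF Q m(2)])
    ultimately show ?thesis using eqI[OF smooth_map_point[OF \<psi> Gz]] eqI[OF z] by metis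
  qed
  have "\<psi> ` points E = points E"
    using smooth_map_point[OF \<psi>] smooth_map_point[OF G] \<psi>G
    by (intro equalityI image_subsetI subsetI) (assumption | metis image_eqI)+
  moreover have "G z = inv_into (points E) \<psi> z" if z: "z \<in> points E" for z
    by (rule inv_into_f_eq[OF inj smooth_map_point[OF G z] \<psi>G[OF z], symmetric])
  then have "smooth_map E E (inv_into (points E) \<psi>)" by (rule smooth_map_cong[OF E E G])
  ultimately show ?thesis using inj \<psi> by (simp add: diffeomorphism_def bij_betw_def)
qed

end

end

theorem theorem3p2:
  fixes Q :: "('q, 'e::finite_dim_inner) manifold"
    and n :: nat
    and h :: real
    and \<phi> :: "('q, 'e) phase_time_point \<Rightarrow> ('q, 'e) phase_time_point"
    and \<psi> :: "('q, 'e) ext_phase_point \<Rightarrow> ('q, 'e) ext_phase_point"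
  assumes "smooth_manifold n Q"
    and "diffeomorphism (phase_time Q) (phase_time Q) \<phi>"
    and "\<forall>x\<in>points (phase_time Q). time_pt (\<phi> x) = time_pt x + h"
    and "smooth_map (ext_phase_space Q) (ext_phase_space Q) \<psi>"
  shows "canonical_transformation Q \<psi> \<phi> \<longleftrightarrow>
    (\<exists>W :: ('q, 'e) phase_time_point \<Rightarrow> real.
       smooth_map (phase_time Q) real_line W \<and>
       eq_2form (phase_time Q)
         (pullback (phase_time Q) (phase_time Q) \<phi> (omega_tilde Q))
         (omega_tilde Q - wedge (d_fun W) (d_fun time_pt)) \<and>
       (\<forall>z\<in>points (ext_phase_space Q).
          proj_mu Q (\<psi> z) = \<phi> (proj_mu Q z) \<and>
          coord_u Q (\<psi> z) = coord_u Q z + W (proj_mu Q z)))"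
    (is "_ \<longleftrightarrow> (\<exists>W. ?generates W)")
proof
  have Q: "smooth_atlas Q" using assms(1) by (simp add: smooth_manifold_def)
  have \<phi>: "smooth_map (phase_time Q) (phase_time Q) \<phi>" using assms(2) by (simp add: diffeomorphism_def)
  note step = bspec[OF assms(3)]
  {
    assume can: "canonical_transformation Q \<psi> \<phi>"
    then have fibred: "\<And>z. z \<in> points (ext_phase_space Q) \<Longrightarrow> proj_mu Q (\<psi> z) = \<phi> (proj_mu Q z)"
      and sympl: "eq_2form (ext_phase_space Q)
       (pullback (ext_phase_space Q) (ext_phase_space Q) \<psi> (Omega_ext Q)) (Omega_ext Q)"
      by (simp_all add: canonical_transformation_def)
    note ctx = Q \<phi> assms(4) step fibred
    show "\<exists>W. ?generates W"
      by (rule exI[of _ "\<lambda>m. coord_u Q (\<psi> (ext_point Q m 0))"])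
        (use pullback_omega_tilde[OF ctx sympl refl] coord_u_psi[OF ctx sympl] fibred in blast)
  next
    assume "\<exists>W. ?generates W"
    then obtain W where W: "smooth_map (phase_time Q) real_line W"
      and \<omega>: "eq_2form (phase_time Q)
         (pullback (phase_time Q) (phase_time Q) \<phi> (omega_tilde Q))
         (omega_tilde Q - wedge (d_fun W) (d_fun time_pt))"
      and fibred: "\<And>z. z \<in> points (ext_phase_space Q) \<Longrightarrow> proj_mu Q (\<psi> z) = \<phi> (proj_mu Q z)"
      and u: "\<And>z. z \<in> points (ext_phase_space Q) \<Longrightarrow> coord_u Q (\<psi> z) = coord_u Q z + W (proj_mu Q z)"
      by blast
    note ctx = Q \<phi> assms(4) step fibred
    show "canonical_transformation Q \<psi> \<phi>"
      unfolding canonical_transformation_def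
      using diffeomorphism_psi[OF ctx assms(2) W u] assms(2) fibred
        symplectic_if_pullback_omega_tilde[OF ctx W \<omega> u] by blast
  }
qed

end
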